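(* For $\alpha>0$ let $\mathbb E[\hat N_{IQF}]$ and $\mathbb E[\hat N_{CQ}]$ denote the means of the stationary distributions of the Non-Degenerate Slowdown diffusion approximations, with parameter $\alpha$, of the Idle-Queue-First policy and of the Central Queue policy. Then $$\sup_{\alpha>0}\frac{\mathbb E[\hat N_{IQF}]}{\mathbb E[\hat N_{CQ}]}=2 .$$
   Context: Fix $\mu>0$ and let $B$ be a standard Brownian motion. The Idle-Queue-First diffusion on $(1,\infty)$ is $$d\hat N_{IQF}(t)=\mu\Big[\frac{1}{\hat N_{IQF}(t)-1}-\alpha\Big]dt+\sqrt{2\mu}\,dB(t).$$ The Central Queue ($M/M/k$) diffusion is the Brownian motion with drift $d\hat N_{CQ}(t)=-\alpha\mu\,dt+\sqrt{2\mu}\,dB(t)+dL(t)$ on $[1,\infty)$ reflected at $1$ ($L$ is the increasing reflection term at $1$); its stationary density is $\alpha e^{-\alpha(n-1)}$, $n\ge1$, so $\mathbb E[\hat N_{CQ}]=1+\frac1\alpha$. *)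

theory Defs
  imports "HOL-Probability.Probability"
begin

text \<open>
  Time is the half-line \<open>t \<ge> 0\<close> inside \<^typ>\<open>real\<close>. Filtrations are formally indexed by all of
  \<^typ>\<open>real\<close>, but a filtration given on \<open>t \<ge> 0\<close> extends by \<open>F t = F 0\<close> for \<open>t < 0\<close>, and values of
  processes at negative times are never used.
\<close>

locale brownian_motion = prob_space M + filtration "space M" F
  for M :: "'w measure" and F :: "real \<Rightarrow> 'w measure" +
  fixes B :: "real \<Rightarrow> 'w \<Rightarrow> real"
  assumes sub_F: "0 \<le> t \<Longrightarrow> sets (F t) \<subseteq> sets M"
    and adapted: "0 \<le> t \<Longrightarrow> B t \<in> borel_measurable (F t)"
    and start: "AE \<omega> in M. B 0 \<omega> = 0"
    and continuous_paths: "AE \<omega> in M. continuous_on {0..} (\<lambda>t. B t \<omega>)"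
    and normal_increments: "\<lbrakk>0 \<le> s; s < t\<rbrakk> \<Longrightarrow>
      distributed M lborel (\<lambda>\<omega>. B t \<omega> - B s \<omega>) (normal_density 0 (sqrt (t - s)))"
    and indep_increments: "\<lbrakk>0 \<le> s; s < t\<rbrakk> \<Longrightarrow>
      indep_set (sets (F s)) (sets (vimage_algebra (space M) (\<lambda>\<omega>. B t \<omega> - B s \<omega>) borel))"

text \<open>
  The noise is additive, so the integrated equations below hold path by path and need no stochastic
  integral. In the first one the integrand is continuous on \<open>{0..t}\<close>, because the path is
  continuous and stays in \<open>(1, \<infinity>)\<close>.
\<close>

locale IQF_diffusion = brownian_motion M F B
  for M :: "'w measure" and F :: "real \<Rightarrow> 'w measure" and B :: "real \<Rightarrow> 'w \<Rightarrow> real" +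
  fixes N :: "real \<Rightarrow> 'w \<Rightarrow> real" and \<mu> \<alpha> :: real
  assumes N_adapted: "0 \<le> t \<Longrightarrow> N t \<in> borel_measurable (F t)"
    and N_continuous: "AE \<omega> in M. continuous_on {0..} (\<lambda>t. N t \<omega>)"
    and N_range: "AE \<omega> in M. \<forall>t\<ge>0. 1 < N t \<omega>"
    and sde: "AE \<omega> in M. \<forall>t\<ge>0. N t \<omega> =
      N 0 \<omega> + integral {0..t} (\<lambda>s. \<mu> * (1 / (N s \<omega> - 1) - \<alpha>)) + sqrt (2 * \<mu>) * B t \<omega>"

text \<open>
  For continuous paths, the last assumption says that the measure \<open>dL\<close> does not charge
  \<open>{t. N t > 1}\<close>: this set is relatively open in \<open>{0..}\<close>, hence a countable union of compact
  intervals on each of which \<open>L\<close> is constant.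
\<close>

locale CQ_diffusion = brownian_motion M F B
  for M :: "'w measure" and F :: "real \<Rightarrow> 'w measure" and B :: "real \<Rightarrow> 'w \<Rightarrow> real" +
  fixes N L :: "real \<Rightarrow> 'w \<Rightarrow> real" and \<mu> \<alpha> :: real
  assumes N_adapted: "0 \<le> t \<Longrightarrow> N t \<in> borel_measurable (F t)"
    and N_continuous: "AE \<omega> in M. continuous_on {0..} (\<lambda>t. N t \<omega>)"
    and N_range: "AE \<omega> in M. \<forall>t\<ge>0. 1 \<le> N t \<omega>"
    and sde: "AE \<omega> in M. \<forall>t\<ge>0. N t \<omega> =
      N 0 \<omega> - \<alpha> * \<mu> * t + sqrt (2 * \<mu>) * B t \<omega> + L t \<omega>"
    and L_adapted: "0 \<le> t \<Longrightarrow> L t \<in> borel_measurable (F t)"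
    and L_start: "AE \<omega> in M. L 0 \<omega> = 0"
    and L_continuous: "AE \<omega> in M. continuous_on {0..} (\<lambda>t. L t \<omega>)"
    and L_mono: "AE \<omega> in M. mono_on {0..} (\<lambda>t. L t \<omega>)"
    and L_reflection: "AE \<omega> in M. \<forall>s t. 0 \<le> s \<longrightarrow> s \<le> t \<longrightarrow>
      (\<forall>u\<in>{s..t}. 1 < N u \<omega>) \<longrightarrow> L s \<omega> = L t \<omega>"

text \<open>
  A stationary distribution is a law \<open>\<pi>\<close> such that some (weak) solution started from \<open>\<pi>\<close> has
  law \<open>\<pi>\<close> at every time. HOL cannot quantify over the type of the sample points within a formula,
  so that type is passed as a parameter.
\<close>

definition stationary_law :: "'w measure \<Rightarrow> (real \<Rightarrow> 'w \<Rightarrow> real) \<Rightarrow> real measure \<Rightarrow> bool" where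
  "stationary_law M N \<pi> \<longleftrightarrow> (\<forall>t\<ge>0. distr M borel (N t) = \<pi>)"

definition IQF_stationary_distribution ::
  "'w itself \<Rightarrow> real \<Rightarrow> real \<Rightarrow> real measure \<Rightarrow> bool" where
  "IQF_stationary_distribution _ \<mu> \<alpha> \<pi> \<longleftrightarrow>
    (\<exists>(M :: 'w measure) F B N. IQF_diffusion M F B N \<mu> \<alpha> \<and> stationary_law M N \<pi>)"

definition CQ_stationary_distribution ::
  "'w itself \<Rightarrow> real \<Rightarrow> real \<Rightarrow> real measure \<Rightarrow> bool" where
  "CQ_stationary_distribution _ \<mu> \<alpha> \<pi> \<longleftrightarrow>
    (\<exists>(M :: 'w measure) F B N L. CQ_diffusion M F B N L \<mu> \<alpha> \<and> stationary_law M N \<pi>)"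

end

(*
Let f be smooth with bounded derivatives and cut [0,1] into n steps. Write f(X_{i+1}) - f(X_i) as
[f(X_{i+1}) - f(X_i + sigma dB_i)] + [f(X_i + sigma dB_i) - f(X_i)]. By independence and Taylor's
formula the second bracket has mean sigma^2/(2n) E f''(X) + O(n^(-3/2)); the first one only involves
the finite variation part of X, so its sum converges path by path to the integral of f'(X) against
it. For f' = y exp(-theta y^2), y = x - 1, stationarity then gives, without stochastic integrals,
  E[(alpha y + 2 theta y^2) exp(-theta y^2)] = c E[exp(-theta y^2)],
where c = 2 for Idle-Queue-First (f'(x)/(x - 1) contributes one) and c = 1 for Central Queue (the
reflection term is killed by f'(1) = 0). Letting theta -> 0 yields the mean 1 + c/alpha, and the
ratio of the means is (alpha + 2)/(alpha + 1).
*)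

theory Submission
  imports Defs
begin

section \<open>Gaussian increments\<close>

text \<open>The identity holds for every stationary law and already pins down its mean. The obstacle
  is that no moment of such a law is known beforehand: the mean might not exist, and
  \<open>1 / (N - 1)\<close> might not be integrable. With f = y^2 / 2 the generator would be mu *
  (c - alpha * y) away from the boundary, which is exactly the wanted relation, but this f is
  unbounded. Damping repairs that: f = - exp(-theta y^2) / (2 theta) is bounded together with its
  derivatives, and the undamped relation returns as theta -> 0. The factor y in f' serves both
  boundary behaviours, cancelling the singular drift in one case and vanishing at the reflecting
  point in the other. The test function must be smooth on the whole line, because the intermediate
  point X_i + sigma dB_i may lie below 1. Noise is added before drift so that dB_i meets only the
  past value X_i, from which it is independent; all dependence on the future of the path is left in
  the drift bracket, which is treated path by path.\<close>

lemma taylor_two_error: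
  fixes f f' f'' f''' :: "real \<Rightarrow> real"
  assumes "\<And>x. (f has_real_derivative f' x) (at x)"
    and "\<And>x. (f' has_real_derivative f'' x) (at x)"
    and "\<And>x. (f'' has_real_derivative f''' x) (at x)"
    and bound: "\<And>x. \<bar>f''' x\<bar> \<le> C"
  shows "\<bar>f (x + y) - f x - (f' x * y + f'' x * y\<^sup>2 / 2)\<bar> \<le> C * \<bar>y\<bar> ^ 3"
proof -
  \<comment> \<open>The Maclaurin theorem expects the derivatives as one family indexed by order;
    \<open>e\<close> below moves the base point to \<open>x\<close>.\<close>
  define d where "d m = (if m = 0 then f else if m = Suc 0 then f' else if m = 2 then f'' else f''')"
    for m :: nat
  have d: "\<forall>m t. m < 3 \<longrightarrow> (d m has_real_derivative d (Suc m) t) (at t)"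
  proof (intro allI impI)
    fix m :: nat and t :: real assume "m < 3"
    then consider "m = 0" | "m = 1" | "m = 2" by linarith
    then show "(d m has_real_derivative d (Suc m) t) (at t)"
      by cases (use assms in \<open>simp_all add: d_def\<close>)
  qed
  show ?thesis
  proof (cases "y = 0")
    case False
    define e where "e m u = d m (x + u)" for m u
    have e: "\<forall>m t. m < 3 \<and> \<bar>t\<bar> \<le> \<bar>y\<bar> \<longrightarrow> (e m has_real_derivative e (Suc m) t) (at t)"
      unfolding e_def using d by (simp add: DERIV_shift[symmetric] add.commute[of x])
    obtain t where t: "e 0 y = (\<Sum>m<3. e m 0 / fact m * y ^ m) + e 3 t / fact 3 * y ^ 3"
      using Maclaurin_bi_le[of e "e 0" 3 y] e by auto
    have "f (x + y) - f x - (f' x * y + f'' x * y\<^sup>2 / 2) = f''' (x + t) / 6 * y ^ 3"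
      using t by (simp add: e_def d_def eval_nat_numeral)
    \<comment> \<open>The factor 1/6 of the Lagrange remainder is given away, since only the cubic
      order matters later.\<close>
    moreover have "\<bar>f''' (x + t) / 6 * y ^ 3\<bar> \<le> C * \<bar>y\<bar> ^ 3"
    proof -
      have "\<bar>f''' (x + t) / 6\<bar> \<le> C" using bound[of "x + t"] by simp
      then show ?thesis unfolding abs_mult power_abs by (rule mult_right_mono) simp
    qed
    ultimately show ?thesis by simp
  qed auto
qed

context brownian_motion
begin

lemma F_measurable_imp: "0 \<le> t \<Longrightarrow> X \<in> borel_measurable (F t) \<Longrightarrow> X \<in> borel_measurable M"
  by (rule measurable_mono[THEN subsetD, OF order_refl refl sub_F[of t] space_F]) auto

lemma B_measurable: "0 \<le> t \<Longrightarrow> B t \<in> borel_measurable M"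
  using F_measurable_imp adapted by blast

lemma increment_moments:
  assumes "0 \<le> s" "s < t"
  shows "integrable M (\<lambda>\<omega>. \<bar>B t \<omega> - B s \<omega>\<bar> ^ k)" "integrable M (\<lambda>\<omega>. (B t \<omega> - B s \<omega>) ^ k)"
    and "expectation (\<lambda>\<omega>. B t \<omega> - B s \<omega>) = 0"
    and "expectation (\<lambda>\<omega>. (B t \<omega> - B s \<omega>)\<^sup>2) = t - s"
    and "expectation (\<lambda>\<omega>. \<bar>B t \<omega> - B s \<omega>\<bar> ^ 3) \<le> 2 * sqrt (t - s) ^ 3"
proof -
  note D = normal_increments[OF assms]
  have pos: "0 < sqrt (t - s)" using assms by simp
  show "integrable M (\<lambda>\<omega>. \<bar>B t \<omega> - B s \<omega>\<bar> ^ k)"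
    using integrable_normal_moment_abs[OF pos, of 0 k]
    by (subst distributed_integrable[OF D, symmetric]) auto
  show "integrable M (\<lambda>\<omega>. (B t \<omega> - B s \<omega>) ^ k)"
    using integrable_normal_moment[OF pos, of 0 k]
    by (subst distributed_integrable[OF D, symmetric]) auto
  show "expectation (\<lambda>\<omega>. B t \<omega> - B s \<omega>) = 0"
    using normal_distributed_expectation[OF pos D] .
  show "expectation (\<lambda>\<omega>. (B t \<omega> - B s \<omega>)\<^sup>2) = t - s"
    using integral_normal_moment_even[OF pos, of 0 1] assms
    by (subst distributed_integral[OF D, symmetric]) (auto simp: eval_nat_numeral)
  have "expectation (\<lambda>\<omega>. \<bar>B t \<omega> - B s \<omega>\<bar> ^ 3) = 2 * sqrt (t - s) ^ 3 * sqrt (2 / pi)"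
    using integral_normal_moment_abs_odd[OF pos, of 0 1] assms
    by (subst distributed_integral[OF D, symmetric]) (auto simp: eval_nat_numeral)
  \<comment> \<open>Here \<open>sqrt (2 / pi) \<le> 1\<close> because pi is at least 2.\<close>
  also have "\<dots> \<le> 2 * sqrt (t - s) ^ 3 * 1"
    using pi_ge_two assms by (intro mult_left_mono) auto
  finally show "expectation (\<lambda>\<omega>. \<bar>B t \<omega> - B s \<omega>\<bar> ^ 3) \<le> 2 * sqrt (t - s) ^ 3" by simp
qed

text \<open>The sigma-algebra generated by \<open>X\<close> lies inside \<open>F s\<close>, so the
  independence of the increment from \<open>F s\<close> is inherited by \<open>X\<close> and then by
  functions of the two variables.\<close>

lemma indep_var_increment:
  fixes X :: "'w \<Rightarrow> real" and \<phi> \<psi> :: "real \<Rightarrow> real"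
  assumes st: "0 \<le> s" "s < t" and X: "X \<in> borel_measurable (F s)"
    and \<phi>: "\<phi> \<in> borel_measurable borel" and \<psi>: "\<psi> \<in> borel_measurable borel"
  shows "indep_var borel (\<lambda>\<omega>. \<phi> (X \<omega>)) borel (\<lambda>\<omega>. \<psi> (B t \<omega> - B s \<omega>))"
proof -
  let ?D = "\<lambda>\<omega>. B t \<omega> - B s \<omega>"
  have XM: "X \<in> borel_measurable M" using F_measurable_imp st X by blast
  have DM: "?D \<in> borel_measurable M" using B_measurable st by simp
  have D': "?D \<in> measurable (vimage_algebra (space M) ?D borel) borel"
    by (rule measurable_vimage_algebra1) auto
  have "sigma_sets (space M) {X -` A \<inter> space M |A. A \<in> sets borel} \<subseteq> sets (F s)"
    using measurable_sets[OF X]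
    by (intro sets.sigma_sets_subset[of _ "F s", unfolded space_F]) (auto simp: space_F)
  moreover have "sigma_sets (space M) {?D -` A \<inter> space M |A. A \<in> sets borel} =
      sets (vimage_algebra (space M) ?D borel)"
    by (simp add: sets_vimage_algebra)
  ultimately have "indep_var borel X borel ?D"
    unfolding indep_var_eq using XM DM indep_increments[OF st]
    by (auto simp: indep_sets2_eq)
  from indep_var_compose[OF this \<phi> \<psi>] show ?thesis by (simp add: comp_def)
qed

text \<open>\<open>X\<close> may have no moments, so integrability comes from the bounds on
  \<open>f\<close> and its derivatives together with the moments of the increment. Independence
  kills the linear Taylor term and factors the quadratic one; the third absolute moment controls the
  rest. The error is of smaller order than the step \<open>t - s\<close>, so even a sum over a whole
  partition of it vanishes.\<close>

lemma gaussian_step: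
  fixes X :: "'w \<Rightarrow> real" and \<sigma> :: real
  assumes st: "0 \<le> s" "s < t" and X: "X \<in> borel_measurable (F s)"
    and f': "\<And>x. (f has_real_derivative f' x) (at x)"
    and f'': "\<And>x. (f' has_real_derivative f'' x) (at x)"
    and f''': "\<And>x. (f'' has_real_derivative f''' x) (at x)"
    and bounds: "\<And>x. \<bar>f x\<bar> \<le> C0" "\<And>x. \<bar>f' x\<bar> \<le> C1" "\<And>x. \<bar>f'' x\<bar> \<le> C2" "\<And>x. \<bar>f''' x\<bar> \<le> C3"
  shows "\<bar>expectation (\<lambda>\<omega>. f (X \<omega> + \<sigma> * (B t \<omega> - B s \<omega>)) - f (X \<omega>))
      - \<sigma>\<^sup>2 / 2 * (t - s) * expectation (\<lambda>\<omega>. f'' (X \<omega>))\<bar> \<le> C3 * (2 * (\<bar>\<sigma>\<bar> * sqrt (t - s)) ^ 3)"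
proof -
  let ?D = "\<lambda>\<omega>. B t \<omega> - B s \<omega>"
  have XM [measurable]: "X \<in> borel_measurable M" using F_measurable_imp st X by blast
  have DM [measurable]: "?D \<in> borel_measurable M" using B_measurable st by simp
  have fm [measurable]: "f \<in> borel_measurable borel" "f' \<in> borel_measurable borel"
      "f'' \<in> borel_measurable borel"
    using DERIV_isCont[OF f'] DERIV_isCont[OF f''] DERIV_isCont[OF f''']
    by (auto intro!: borel_measurable_continuous_onI continuous_at_imp_continuous_on)
  have i0: "integrable M (\<lambda>\<omega>. f (X \<omega> + \<sigma> * ?D \<omega>))" "integrable M (\<lambda>\<omega>. f (X \<omega>))"
    by (rule integrable_const_bound[of _ C0]; use bounds in simp)+
  have i1: "integrable M (\<lambda>\<omega>. f' (X \<omega>))"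
    by (rule integrable_const_bound[of _ C1]; use bounds in simp)+
  have i2: "integrable M (\<lambda>\<omega>. f'' (X \<omega>))"
    by (rule integrable_const_bound[of _ C2]; use bounds in simp)+
  note mom = increment_moments[OF st]
  have iD: "integrable M ?D" using mom(2)[of 1] unfolding power_one_right .
  have iv1: "indep_var borel (\<lambda>\<omega>. f' (X \<omega>)) borel ?D"
    by (rule indep_var_increment[OF st X, of f' "\<lambda>x. x"]) auto
  have iv2: "indep_var borel (\<lambda>\<omega>. f'' (X \<omega>)) borel (\<lambda>\<omega>. (?D \<omega>)\<^sup>2)"
    by (rule indep_var_increment[OF st X, of f'' "\<lambda>x. x\<^sup>2"]) auto
  note j1 = indep_var_integrable[OF iv1 i1 iD]
  note j2 = indep_var_integrable[OF iv2 i2 mom(2)[of 2]]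
  have e1: "expectation (\<lambda>\<omega>. f' (X \<omega>) * ?D \<omega>) = 0"
    using indep_var_lebesgue_integral[OF iv1 i1 iD] mom(3) by simp
  have e2: "expectation (\<lambda>\<omega>. f'' (X \<omega>) * (?D \<omega>)\<^sup>2) = expectation (\<lambda>\<omega>. f'' (X \<omega>)) * (t - s)"
    using indep_var_lebesgue_integral[OF iv2 i2 mom(2)[of 2]] mom(4) by simp
  define R where "R \<omega> = f (X \<omega> + \<sigma> * ?D \<omega>) - f (X \<omega>)
    - (\<sigma> * (f' (X \<omega>) * ?D \<omega>) + \<sigma>\<^sup>2 / 2 * (f'' (X \<omega>) * (?D \<omega>)\<^sup>2))" for \<omega>
  have iR: "integrable M R" unfolding R_def using i0 j1 j2 by (intro Bochner_Integration.integrable_diff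
        Bochner_Integration.integrable_add integrable_mult_right) auto
  have R: "\<bar>R \<omega>\<bar> \<le> C3 * (\<bar>\<sigma>\<bar> ^ 3 * \<bar>?D \<omega>\<bar> ^ 3)" for \<omega>
    using taylor_two_error[OF f' f'' f''' bounds(4), of "X \<omega>" "\<sigma> * ?D \<omega>"]
    unfolding R_def power_mult_distrib abs_mult by (simp only: ac_simps times_divide_eq_right times_divide_eq_left)
  have C3: "0 \<le> C3" using bounds(4)[of 0] by linarith
  have "expectation R = expectation (\<lambda>\<omega>. f (X \<omega> + \<sigma> * ?D \<omega>) - f (X \<omega>))
      - (expectation (\<lambda>\<omega>. \<sigma> * (f' (X \<omega>) * ?D \<omega>)) + expectation (\<lambda>\<omega>. \<sigma>\<^sup>2 / 2 * (f'' (X \<omega>) * (?D \<omega>)\<^sup>2)))"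
    unfolding R_def using i0 j1 j2
    by (subst Bochner_Integration.integral_diff) (auto intro!: integrable_mult_right)
  also have "\<dots> = expectation (\<lambda>\<omega>. f (X \<omega> + \<sigma> * ?D \<omega>) - f (X \<omega>))
      - \<sigma>\<^sup>2 / 2 * (t - s) * expectation (\<lambda>\<omega>. f'' (X \<omega>))"
    using e1 e2 by simp
  finally have eR: "expectation (\<lambda>\<omega>. f (X \<omega> + \<sigma> * ?D \<omega>) - f (X \<omega>))
      - \<sigma>\<^sup>2 / 2 * (t - s) * expectation (\<lambda>\<omega>. f'' (X \<omega>)) = expectation R" by simp
  have "\<bar>expectation R\<bar> \<le> expectation (\<lambda>\<omega>. \<bar>R \<omega>\<bar>)" by (rule integral_abs_bound)
  also have "\<dots> \<le> expectation (\<lambda>\<omega>. C3 * (\<bar>\<sigma>\<bar> ^ 3 * \<bar>?D \<omega>\<bar> ^ 3))"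
    using iR mom(1)[of 3] R by (intro integral_mono) (auto intro!: integrable_mult_right)
  also have "\<dots> = C3 * (\<bar>\<sigma>\<bar> ^ 3 * expectation (\<lambda>\<omega>. \<bar>?D \<omega>\<bar> ^ 3))" by simp
  also have "\<dots> \<le> C3 * (\<bar>\<sigma>\<bar> ^ 3 * (2 * sqrt (t - s) ^ 3))"
    using mom(5) C3 by (intro mult_left_mono) auto
  finally show ?thesis using eR by (simp add: power_mult_distrib algebra_simps)
qed

end

text \<open>
  Neither \<open>U\<close> nor \<open>W\<close> need be integrable: the clamped variables \<open>c k U\<close> and \<open>c k W\<close> have equal
  means, so the positive part of their difference has the same mean as its negative part, which
  is controlled by \<open>Y\<close>; then Fatou.
\<close>

lemma (in prob_space) integrable_diff_equal_law:
  fixes U W Y :: "'a \<Rightarrow> real"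
  assumes U [measurable]: "U \<in> borel_measurable M" and W [measurable]: "W \<in> borel_measurable M"
    and law: "distr M borel U = distr M borel W"
    and Y: "integrable M Y" and lower: "AE \<omega> in M. Y \<omega> \<le> U \<omega> - W \<omega>"
  shows "integrable M (\<lambda>\<omega>. U \<omega> - W \<omega>)"
proof -
  define c where "c k x = max (- real k) (min (real k) x)" for k :: nat and x :: real
  have [measurable]: "c k \<in> borel_measurable borel" for k unfolding c_def by measurable
  have cb: "\<bar>c k x\<bar> \<le> real k" for k x unfolding c_def by auto
  have ci: "integrable M (\<lambda>\<omega>. c k (U \<omega>))" "integrable M (\<lambda>\<omega>. c k (W \<omega>))" for k
    by (rule integrable_const_bound[of _ "real k"]; use cb in simp)+
  define D where "D k \<omega> = c k (U \<omega>) - c k (W \<omega>)" for k \<omega>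
  have [measurable]: "D k \<in> borel_measurable M" for k unfolding D_def by measurable
  have Di: "integrable M (D k)" for k unfolding D_def using ci by simp
  have D0: "expectation (D k) = 0" for k
  proof -
    have "expectation (\<lambda>\<omega>. c k (U \<omega>)) = (\<integral>x. c k x \<partial>distr M borel U)"
      by (simp add: integral_distr)
    also have "\<dots> = expectation (\<lambda>\<omega>. c k (W \<omega>))" by (simp add: law integral_distr)
    finally show ?thesis unfolding D_def using ci by simp
  qed
  \<comment> \<open>The clamp \<open>c k\<close> is monotone and 1-Lipschitz, so the negative part
    of \<open>D k\<close> is at most \<open>\<bar>Y\<bar>\<close>; the absolute value is the
    variable plus twice its negative part.\<close>
  have bound: "AE \<omega> in M. \<bar>D k \<omega>\<bar> \<le> D k \<omega> + 2 * \<bar>Y \<omega>\<bar>" for k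
  proof -
    have mono: "x \<le> y \<Longrightarrow> c k x \<le> c k y" and lip: "x \<le> y \<Longrightarrow> c k y - c k x \<le> y - x" for x y
      unfolding c_def max_def min_def by (auto split: if_splits)
    show ?thesis using lower
    proof eventually_elim
      case (elim \<omega>)
      then show ?case using mono[of "U \<omega>" "W \<omega>"] mono[of "W \<omega>" "U \<omega>"] lip[of "U \<omega>" "W \<omega>"]
        unfolding D_def by linarith
    qed
  qed
  have nn: "(\<integral>\<^sup>+\<omega>. \<bar>D k \<omega>\<bar> \<partial>M) \<le> ennreal (2 * expectation (\<lambda>\<omega>. \<bar>Y \<omega>\<bar>))" for k
  proof -
    have "(\<integral>\<^sup>+\<omega>. \<bar>D k \<omega>\<bar> \<partial>M) = ennreal (expectation (\<lambda>\<omega>. \<bar>D k \<omega>\<bar>))"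
      using Di by (intro nn_integral_eq_integral) auto
    also have "expectation (\<lambda>\<omega>. \<bar>D k \<omega>\<bar>) \<le> expectation (\<lambda>\<omega>. D k \<omega> + 2 * \<bar>Y \<omega>\<bar>)"
      using Di Y bound by (intro integral_mono_AE) auto
    also have "\<dots> = 2 * expectation (\<lambda>\<omega>. \<bar>Y \<omega>\<bar>)" using Di Y D0 by simp
    finally show ?thesis by (simp add: ennreal_leI)
  qed
  have lim: "(\<lambda>k. D k \<omega>) \<longlonglongrightarrow> U \<omega> - W \<omega>" for \<omega>
  proof (rule tendsto_eventually)
    obtain n :: nat where n: "\<bar>U \<omega>\<bar> + \<bar>W \<omega>\<bar> \<le> real n" using real_arch_simple by blast
    show "\<forall>\<^sub>F k in sequentially. D k \<omega> = U \<omega> - W \<omega>"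
      using eventually_ge_at_top[of n]
    proof eventually_elim
      case (elim k)
      then have "\<bar>U \<omega>\<bar> + \<bar>W \<omega>\<bar> \<le> real k" using n of_nat_mono[of n k] by (smt (verit))
      then show ?case by (auto simp: D_def c_def)
    qed
  qed
  have "(\<integral>\<^sup>+\<omega>. \<bar>U \<omega> - W \<omega>\<bar> \<partial>M) = (\<integral>\<^sup>+\<omega>. liminf (\<lambda>k. ennreal \<bar>D k \<omega>\<bar>) \<partial>M)"
    by (intro nn_integral_cong lim_imp_Liminf[symmetric] tendsto_intros lim) auto
  also have "\<dots> \<le> liminf (\<lambda>k. \<integral>\<^sup>+\<omega>. \<bar>D k \<omega>\<bar> \<partial>M)" by (rule nn_integral_liminf) simp
  also have "\<dots> \<le> limsup (\<lambda>k. \<integral>\<^sup>+\<omega>. \<bar>D k \<omega>\<bar> \<partial>M)" by (rule Liminf_le_Limsup) simp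
  also have "\<dots> \<le> ennreal (2 * expectation (\<lambda>\<omega>. \<bar>Y \<omega>\<bar>))"
    by (rule Limsup_bounded) (use nn in simp)
  also have "\<dots> < \<infinity>" by simp
  finally show ?thesis by (intro integrableI_bounded) simp_all
qed

section \<open>Convergence along partitions\<close>

text \<open>On fine partitions each summand is at most \<open>e\<close> times an increment of
  \<open>V\<close>, and these increments telescope. \<open>V\<close> acts as a clock: it will be
  time itself for an absolutely continuous drift, and time plus the reflection term for the
  reflected path.\<close>

lemma partition_sum_tendsto_zero:
  fixes q :: "real \<Rightarrow> real \<Rightarrow> real" and V :: "real \<Rightarrow> real"
  assumes "\<And>e. 0 < e \<Longrightarrow> \<exists>d>0. \<forall>s t. 0 \<le> s \<longrightarrow> s < t \<longrightarrow> t \<le> 1 \<longrightarrow> t - s < d \<longrightarrow>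
      \<bar>q s t\<bar> \<le> e * (V t - V s)"
    and V: "V 0 \<le> V 1"
  shows "(\<lambda>n. \<Sum>i<n. q (real i / real n) (real (Suc i) / real n)) \<longlonglongrightarrow> 0"
proof (rule LIMSEQ_I)
  fix r :: real assume "0 < r"
  define w where "w = V 1 - V 0 + 1"
  define e where "e = r / (2 * w)"
  have w: "0 < w" using V by (simp add: w_def)
  have e0: "0 < e" using \<open>0 < r\<close> w by (simp add: e_def)
  have "e * (V 1 - V 0) \<le> e * w" using e0 by (simp add: w_def)
  also have "\<dots> = r / 2" using w by (simp add: e_def)
  finally have e: "0 < e" "e * (V 1 - V 0) < r" using \<open>0 < r\<close> e0 by auto
  obtain d where d: "0 < d" "\<And>s t. 0 \<le> s \<Longrightarrow> s < t \<Longrightarrow> t \<le> 1 \<Longrightarrow> t - s < d \<Longrightarrow>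
      \<bar>q s t\<bar> \<le> e * (V t - V s)" using assms(1)[OF e(1)] by blast
  obtain n0 :: nat where n0: "1 / d < real n0" using reals_Archimedean2 by blast
  show "\<exists>no. \<forall>n\<ge>no. norm ((\<Sum>i<n. q (real i / real n) (real (Suc i) / real n)) - 0) < r"
  proof (intro exI[of _ "Suc n0"] allI impI)
    fix n assume n: "Suc n0 \<le> n"
    then have np: "0 < real n" by simp
    have "1 / d < real n" using n n0 by (smt (verit) of_nat_Suc of_nat_mono)
    then have nd: "1 / real n < d" using d(1) np by (simp add: field_simps)
    have "\<bar>\<Sum>i<n. q (real i / real n) (real (Suc i) / real n)\<bar> \<le>
        (\<Sum>i<n. \<bar>q (real i / real n) (real (Suc i) / real n)\<bar>)" by (rule sum_abs)
    also have "\<dots> \<le> (\<Sum>i<n. e * (V (real (Suc i) / real n) - V (real i / real n)))"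
    proof (rule sum_mono)
      fix i assume "i \<in> {..<n}"
      then have i: "real (Suc i) \<le> real n" by simp
      have "real (Suc i) / real n - real i / real n = 1 / real n" by (simp add: diff_divide_distrib[symmetric])
      then show "\<bar>q (real i / real n) (real (Suc i) / real n)\<bar> \<le>
          e * (V (real (Suc i) / real n) - V (real i / real n))"
        using np nd i by (intro d(2)) (auto simp: divide_strict_right_mono)
    qed
    also have "\<dots> = e * (V 1 - V 0)"
      using np by (simp add: sum_distrib_left[symmetric] sum_lessThan_telescope[of "\<lambda>i. V (real i / real n)", simplified])
    finally show "norm ((\<Sum>i<n. q (real i / real n) (real (Suc i) / real n)) - 0) < r" using e(2) by simp
  qed
qed

lemma mvt_between:
  fixes f f' :: "real \<Rightarrow> real"
  assumes "\<And>x. (f has_real_derivative f' x) (at x)"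
  obtains z where "min a b \<le> z" "z \<le> max a b" "f a - f b = f' z * (a - b)"
proof -
  consider "a < b" | "a = b" | "b < a" by linarith
  then show ?thesis
  proof cases
    case 1
    from MVT2[OF this, of f f'] assms obtain z where "a < z" "z < b" "f b - f a = (b - a) * f' z" by auto
    then show ?thesis using 1 by (intro that[of z]) (auto simp: algebra_simps)
  next
    case 2
    then show ?thesis by (intro that[of a]) auto
  next
    case 3
    from MVT2[OF this, of f f'] assms obtain z where "b < z" "z < a" "f a - f b = (a - b) * f' z" by auto
    then show ?thesis using 3 by (intro that[of z]) (auto simp: algebra_simps)
  qed
qed

lemma deriv_bound_lipschitz:
  fixes f f' :: "real \<Rightarrow> real"
  assumes d: "\<And>x. (f has_real_derivative f' x) (at x)" and b: "\<And>x. \<bar>f' x\<bar> \<le> C"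
  shows "\<bar>f a - f b\<bar> \<le> C * \<bar>a - b\<bar>"
proof -
  obtain z where "f a - f b = f' z * (a - b)" using mvt_between[of f f' a b] d by blast
  then show ?thesis using b[of z] by (simp add: abs_mult mult_right_mono)
qed

lemma uniform_modulus:
  fixes x :: "real \<Rightarrow> real"
  assumes "continuous_on {0..1} x" "0 < e"
  obtains d where "0 < d"
    "\<And>s t. 0 \<le> s \<Longrightarrow> s \<le> 1 \<Longrightarrow> 0 \<le> t \<Longrightarrow> t \<le> 1 \<Longrightarrow> \<bar>t - s\<bar> < d \<Longrightarrow> \<bar>x t - x s\<bar> < e"
proof -
  have "uniformly_continuous_on {0..1} x" using assms(1) by (rule compact_uniformly_continuous) simp
  then obtain d where "0 < d" "\<And>s t. s \<in> {0..1} \<Longrightarrow> t \<in> {0..1} \<Longrightarrow> dist t s < d \<Longrightarrow> dist (x t) (x s) < e"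
    unfolding uniformly_continuous_on_def using assms(2) by metis
  then show ?thesis by (intro that[of d]) (auto simp: dist_real_def)
qed

section \<open>The finite variation part along a single path\<close>

text \<open>By the mean value theorem the difference of \<open>f\<close> is \<open>f' z\<close>
  times the integral of \<open>h\<close> over the step, with \<open>z\<close> near
  \<open>x s\<close>. Moving \<open>z\<close> to \<open>x s\<close> and freezing \<open>h\<close> at
  the left end costs a small multiple of the step. The comparison is with left-point sums of
  \<open>g\<close> instead of a time integral, because under a stationary law every such term has
  the same mean. \<open>g\<close> is a function of the state alone, given separately from
  \<open>h\<close>, so that it can be bounded where the drift is singular.\<close>

lemma drift_sum_tendsto_zero:
  fixes x \<beta> h f f' f'' g :: "real \<Rightarrow> real"
  assumes x: "continuous_on {0..1} x" and \<beta>: "continuous_on {0..1} \<beta>" and h: "continuous_on {0..1} h"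
    and eq: "\<And>s t. 0 \<le> s \<Longrightarrow> s \<le> t \<Longrightarrow> t \<le> 1 \<Longrightarrow> x t - x s - \<sigma> * (\<beta> t - \<beta> s) = integral {s..t} h"
    and f': "\<And>x. (f has_real_derivative f' x) (at x)"
    and f'': "\<And>x. (f' has_real_derivative f'' x) (at x)"
    and b1: "\<And>x. \<bar>f' x\<bar> \<le> C1" and b2: "\<And>x. \<bar>f'' x\<bar> \<le> C2"
    and g: "\<And>t. 0 \<le> t \<Longrightarrow> t \<le> 1 \<Longrightarrow> g (x t) = f' (x t) * h t"
  shows "(\<lambda>n. \<Sum>i<n. f (x (real (Suc i) / real n))
      - f (x (real i / real n) + \<sigma> * (\<beta> (real (Suc i) / real n) - \<beta> (real i / real n)))
      - (real (Suc i) / real n - real i / real n) * g (x (real i / real n))) \<longlonglongrightarrow> 0"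
proof (rule partition_sum_tendsto_zero[where V = "\<lambda>t. t" and
      q = "\<lambda>s t. f (x t) - f (x s + \<sigma> * (\<beta> t - \<beta> s)) - (t - s) * g (x s)"])
  fix e :: real assume "0 < e"
  have C: "0 \<le> C1" "0 \<le> C2" using b1[of 0] b2[of 0] by linarith+
  have "bounded (h ` {0..1})" using compact_imp_bounded[OF compact_continuous_image[OF h]] by simp
  then obtain H where H: "0 < H" "\<And>t. 0 \<le> t \<Longrightarrow> t \<le> 1 \<Longrightarrow> \<bar>h t\<bar> \<le> H"
    unfolding bounded_pos by auto
  \<comment> \<open>The first summand pays for replacing \<open>f' z\<close> by
    \<open>f' (x s)\<close> against an integral of size \<open>H * (t - s)\<close>, the second for
    freezing \<open>h\<close>. Dividing by \<open>K + 1\<close> below covers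
    \<open>K = 0\<close>.\<close>
  define K where "K = C2 * (1 + \<bar>\<sigma>\<bar>) * H + C1"
  have K: "0 \<le> K" using C H by (simp add: K_def)
  define \<eta> where "\<eta> = e / (K + 1)"
  have \<eta>: "0 < \<eta>" "K * \<eta> \<le> e" using \<open>0 < e\<close> K by (auto simp: \<eta>_def field_simps)
  obtain d1 where d1: "0 < d1"
    "\<And>s t. 0 \<le> s \<Longrightarrow> s \<le> 1 \<Longrightarrow> 0 \<le> t \<Longrightarrow> t \<le> 1 \<Longrightarrow> \<bar>t - s\<bar> < d1 \<Longrightarrow> \<bar>x t - x s\<bar> < \<eta>"
    using uniform_modulus[OF x \<eta>(1)] by metis
  obtain d2 where d2: "0 < d2"
    "\<And>s t. 0 \<le> s \<Longrightarrow> s \<le> 1 \<Longrightarrow> 0 \<le> t \<Longrightarrow> t \<le> 1 \<Longrightarrow> \<bar>t - s\<bar> < d2 \<Longrightarrow> \<bar>\<beta> t - \<beta> s\<bar> < \<eta>"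
    using uniform_modulus[OF \<beta> \<eta>(1)] by metis
  obtain d3 where d3: "0 < d3"
    "\<And>s t. 0 \<le> s \<Longrightarrow> s \<le> 1 \<Longrightarrow> 0 \<le> t \<Longrightarrow> t \<le> 1 \<Longrightarrow> \<bar>t - s\<bar> < d3 \<Longrightarrow> \<bar>h t - h s\<bar> < \<eta>"
    using uniform_modulus[OF h \<eta>(1)] by metis
  show "\<exists>d>0. \<forall>s t. 0 \<le> s \<longrightarrow> s < t \<longrightarrow> t \<le> 1 \<longrightarrow> t - s < d \<longrightarrow>
      \<bar>f (x t) - f (x s + \<sigma> * (\<beta> t - \<beta> s)) - (t - s) * g (x s)\<bar> \<le> e * (t - s)"
  proof (intro exI[of _ "min d1 (min d2 d3)"] conjI allI impI)
    show "0 < min d1 (min d2 d3)" using d1(1) d2(1) d3(1) by simp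
    fix s t :: real assume st: "0 \<le> s" "s < t" "t \<le> 1" "t - s < min d1 (min d2 d3)"
    define I where "I = integral {s..t} h"
    have hc: "continuous_on {s..t} h" by (rule continuous_on_subset[OF h]) (use st in auto)
    have xt: "x t - (x s + \<sigma> * (\<beta> t - \<beta> s)) = I" using eq[of s t] st by (simp add: I_def)
    have I: "\<bar>I\<bar> \<le> H * (t - s)"
      unfolding I_def using integral_bound[OF _ hc, of H] H(2) st by auto
    have "norm (integral {s..t} (\<lambda>u. h u - h s)) \<le> \<eta> * (t - s)"
    proof (rule integral_bound)
      fix u assume "u \<in> {s..t}"
      then show "norm (h u - h s) \<le> \<eta>" using d3(2)[of s u] st by auto
    qed (use st hc in \<open>auto intro: continuous_intros\<close>)
    moreover have "integral {s..t} (\<lambda>u. h u - h s) = I - (t - s) * h s"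
      using hc st by (simp add: I_def Henstock_Kurzweil_Integration.integral_diff integrable_continuous_real)
    ultimately have I': "\<bar>I - (t - s) * h s\<bar> \<le> \<eta> * (t - s)" by simp
    obtain z where z: "min (x t) (x s + \<sigma> * (\<beta> t - \<beta> s)) \<le> z" "z \<le> max (x t) (x s + \<sigma> * (\<beta> t - \<beta> s))"
      and fz: "f (x t) - f (x s + \<sigma> * (\<beta> t - \<beta> s)) = f' z * I"
      using mvt_between[of f f' "x t" "x s + \<sigma> * (\<beta> t - \<beta> s)"] f' xt by metis
    have "\<bar>\<sigma> * (\<beta> t - \<beta> s)\<bar> \<le> \<bar>\<sigma>\<bar> * \<eta>" using d2(2)[of s t] st by (auto simp: abs_mult intro!: mult_left_mono)
    moreover have "\<bar>x t - x s\<bar> \<le> \<eta>" using d1(2)[of s t] st by auto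
    moreover have "0 \<le> \<bar>\<sigma>\<bar> * \<eta>" using \<eta> by simp
    ultimately have "\<bar>z - x s\<bar> \<le> \<eta> + \<bar>\<sigma>\<bar> * \<eta>" using z \<eta>(1) by linarith
    then have "\<bar>z - x s\<bar> \<le> (1 + \<bar>\<sigma>\<bar>) * \<eta>" by (simp add: algebra_simps)
    then have fd: "\<bar>f' z - f' (x s)\<bar> \<le> C2 * ((1 + \<bar>\<sigma>\<bar>) * \<eta>)"
      using deriv_bound_lipschitz[OF f'' b2, of z "x s"] C by (meson mult_left_mono order_trans)
    have "f' z * I - (t - s) * g (x s) = (f' z - f' (x s)) * I + f' (x s) * (I - (t - s) * h s)"
      using g[of s] st by (simp add: algebra_simps)
    also have "\<bar>\<dots>\<bar> \<le> \<bar>f' z - f' (x s)\<bar> * \<bar>I\<bar> + \<bar>f' (x s)\<bar> * \<bar>I - (t - s) * h s\<bar>"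
      by (metis abs_mult abs_triangle_ineq)
    also have "\<dots> \<le> (C2 * ((1 + \<bar>\<sigma>\<bar>) * \<eta>)) * (H * (t - s)) + C1 * (\<eta> * (t - s))"
      using fd I I' b1[of "x s"] C \<eta> by (intro add_mono mult_mono) auto
    also have "\<dots> = (K * \<eta>) * (t - s)" by (simp add: K_def algebra_simps)
    also have "\<dots> \<le> e * (t - s)" using \<eta>(2) st by (intro mult_right_mono) auto
    finally show "\<bar>f (x t) - f (x s + \<sigma> * (\<beta> t - \<beta> s)) - (t - s) * g (x s)\<bar> \<le> e * (t - s)"
      using fz by simp
  qed
qed auto

text \<open>No rate of growth of \<open>l\<close> in time is available, so errors are measured by
  the clock \<open>t + l t\<close>. On a short step where \<open>l\<close> increases, the path
  visits \<open>r\<close>, and there \<open>f'\<close> vanishes; hence \<open>f' z\<close> is small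
  exactly on the steps where it multiplies an increment of \<open>l\<close>. The drift
  \<open>- a\<close> is handled as in the previous lemma.\<close>

lemma reflection_sum_tendsto_zero:
  fixes x \<beta> l f f' f'' :: "real \<Rightarrow> real"
  assumes x: "continuous_on {0..1} x" and \<beta>: "continuous_on {0..1} \<beta>"
    and eq: "\<And>s t. 0 \<le> s \<Longrightarrow> s \<le> t \<Longrightarrow> t \<le> 1 \<Longrightarrow>
      x t - x s - \<sigma> * (\<beta> t - \<beta> s) = (l t - l s) - a * (t - s)"
    and a: "0 \<le> a"
    and mono: "\<And>s t. 0 \<le> s \<Longrightarrow> s \<le> t \<Longrightarrow> t \<le> 1 \<Longrightarrow> l s \<le> l t"
    and range: "\<And>t. 0 \<le> t \<Longrightarrow> t \<le> 1 \<Longrightarrow> r \<le> x t"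
    and refl: "\<And>s t. 0 \<le> s \<Longrightarrow> s \<le> t \<Longrightarrow> t \<le> 1 \<Longrightarrow> (\<And>u. s \<le> u \<Longrightarrow> u \<le> t \<Longrightarrow> r < x u) \<Longrightarrow> l s = l t"
    and f': "\<And>x. (f has_real_derivative f' x) (at x)"
    and f'': "\<And>x. (f' has_real_derivative f'' x) (at x)"
    and b2: "\<And>x. \<bar>f'' x\<bar> \<le> C2"
    and f'r: "f' r = 0"
  shows "(\<lambda>n. \<Sum>i<n. f (x (real (Suc i) / real n))
      - f (x (real i / real n) + \<sigma> * (\<beta> (real (Suc i) / real n) - \<beta> (real i / real n)))
      - (real (Suc i) / real n - real i / real n) * (- a * f' (x (real i / real n)))) \<longlonglongrightarrow> 0"
proof (rule partition_sum_tendsto_zero[where V = "\<lambda>t. t + l t" and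
      q = "\<lambda>s t. f (x t) - f (x s + \<sigma> * (\<beta> t - \<beta> s)) - (t - s) * (- a * f' (x s))"])
  show "0 + l 0 \<le> 1 + l 1" using mono[of 0 1] by simp
  fix e :: real assume "0 < e"
  have C: "0 \<le> C2" using b2[of 0] by linarith
  \<comment> \<open>The point \<open>z\<close> is within
    \<open>(1 + \<bar>\<sigma>\<bar>) * \<eta>\<close> of \<open>x s\<close>, and one more
    \<open>\<eta>\<close> reaches any \<open>x u\<close> of the same step, in particular a visit to
    \<open>r\<close>. The factor \<open>a + 1\<close> absorbs the increments of \<open>l\<close> and
    of time into one increment of the clock.\<close>
  define K where "K = C2 * (2 + \<bar>\<sigma>\<bar>) * (a + 1)"
  have K: "0 \<le> K" using C a by (simp add: K_def)
  define \<eta> where "\<eta> = e / (K + 1)"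
  have \<eta>: "0 < \<eta>" "K * \<eta> \<le> e" using \<open>0 < e\<close> K by (auto simp: \<eta>_def field_simps)
  obtain d1 where d1: "0 < d1"
    "\<And>s t. 0 \<le> s \<Longrightarrow> s \<le> 1 \<Longrightarrow> 0 \<le> t \<Longrightarrow> t \<le> 1 \<Longrightarrow> \<bar>t - s\<bar> < d1 \<Longrightarrow> \<bar>x t - x s\<bar> < \<eta>"
    using uniform_modulus[OF x \<eta>(1)] by metis
  obtain d2 where d2: "0 < d2"
    "\<And>s t. 0 \<le> s \<Longrightarrow> s \<le> 1 \<Longrightarrow> 0 \<le> t \<Longrightarrow> t \<le> 1 \<Longrightarrow> \<bar>t - s\<bar> < d2 \<Longrightarrow> \<bar>\<beta> t - \<beta> s\<bar> < \<eta>"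
    using uniform_modulus[OF \<beta> \<eta>(1)] by metis
  show "\<exists>d>0. \<forall>s t. 0 \<le> s \<longrightarrow> s < t \<longrightarrow> t \<le> 1 \<longrightarrow> t - s < d \<longrightarrow>
      \<bar>f (x t) - f (x s + \<sigma> * (\<beta> t - \<beta> s)) - (t - s) * (- a * f' (x s))\<bar> \<le> e * (t + l t - (s + l s))"
  proof (intro exI[of _ "min d1 d2"] conjI allI impI)
    show "0 < min d1 d2" using d1(1) d2(1) by simp
    fix s t :: real assume st: "0 \<le> s" "s < t" "t \<le> 1" "t - s < min d1 d2"
    define D where "D = l t - l s"
    have D: "0 \<le> D" using mono[of s t] st by (simp add: D_def)
    have xt: "x t - (x s + \<sigma> * (\<beta> t - \<beta> s)) = D - a * (t - s)" using eq[of s t] st by (simp add: D_def)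
    obtain z where z: "min (x t) (x s + \<sigma> * (\<beta> t - \<beta> s)) \<le> z" "z \<le> max (x t) (x s + \<sigma> * (\<beta> t - \<beta> s))"
      and fz: "f (x t) - f (x s + \<sigma> * (\<beta> t - \<beta> s)) = f' z * (D - a * (t - s))"
      using mvt_between[of f f' "x t" "x s + \<sigma> * (\<beta> t - \<beta> s)"] f' xt by metis
    have "\<bar>\<sigma> * (\<beta> t - \<beta> s)\<bar> \<le> \<bar>\<sigma>\<bar> * \<eta>" using d2(2)[of s t] st by (auto simp: abs_mult intro!: mult_left_mono)
    moreover have "\<bar>x t - x s\<bar> \<le> \<eta>" using d1(2)[of s t] st by auto
    moreover have "0 \<le> \<bar>\<sigma>\<bar> * \<eta>" using \<eta> by simp
    ultimately have zs: "\<bar>z - x s\<bar> \<le> \<eta> + \<bar>\<sigma>\<bar> * \<eta>" using z \<eta>(1) by linarith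
    define E where "E = C2 * ((2 + \<bar>\<sigma>\<bar>) * \<eta>)"
    have E: "0 \<le> E" using C \<eta> by (simp add: E_def)
    have fd: "\<bar>f' z - f' (x u)\<bar> \<le> E" if "s \<le> u" "u \<le> t" for u
    proof -
      have "\<bar>x u - x s\<bar> < \<eta>" using d1(2)[of s u] st that by auto
      then have "\<bar>z - x u\<bar> \<le> (2 + \<bar>\<sigma>\<bar>) * \<eta>" using zs by (simp add: algebra_simps)
      then show ?thesis unfolding E_def
        using deriv_bound_lipschitz[OF f'' b2, of z "x u"] C by (meson mult_left_mono order_trans)
    qed
    \<comment> \<open>If \<open>l\<close> grows on \<open>{s..t}\<close>, the path visits \<open>r\<close>, where \<open>f'\<close> vanishes.\<close>
    have fD: "\<bar>f' z * D\<bar> \<le> E * D"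
    proof (cases "D = 0")
      case False
      then obtain u where u: "s \<le> u" "u \<le> t" "\<not> r < x u" using refl[of s t] st by (auto simp: D_def)
      then have "x u = r" using range[of u] st by simp
      then have "\<bar>f' z\<bar> \<le> E" using fd[of u] u f'r by simp
      then show ?thesis using D by (simp add: abs_mult mult_right_mono)
    qed simp
    have "f' z * (D - a * (t - s)) - (t - s) * (- a * f' (x s)) =
        f' z * D - (f' z - f' (x s)) * (a * (t - s))"
      by (simp add: algebra_simps)
    also have "\<bar>\<dots>\<bar> \<le> \<bar>f' z * D\<bar> + \<bar>f' z - f' (x s)\<bar> * (a * (t - s))"
      using a st by (simp add: abs_mult abs_triangle_ineq4[THEN order_trans])
    also have "\<dots> \<le> E * D + E * (a * (t - s))"
      using fD fd[of s] a st by (intro add_mono mult_right_mono) auto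
    also have "\<dots> \<le> E * ((a + 1) * (t + l t - (s + l s)))"
    proof -
      have "D + a * (t - s) \<le> (a + 1) * (t + l t - (s + l s))"
        using a D st mult_nonneg_nonneg[OF a D] unfolding D_def by (simp add: algebra_simps)
      then show ?thesis using mult_left_mono[OF _ E] by (simp add: distrib_left[symmetric])
    qed
    also have "\<dots> = (K * \<eta>) * (t + l t - (s + l s))" by (simp add: K_def E_def)
    also have "\<dots> \<le> e * (t + l t - (s + l s))"
      using \<eta>(2) st D by (intro mult_right_mono) (auto simp: D_def)
    finally show "\<bar>f (x t) - f (x s + \<sigma> * (\<beta> t - \<beta> s)) - (t - s) * (- a * f' (x s))\<bar>
        \<le> e * (t + l t - (s + l s))"
      using fz by simp
  qed
qed

text \<open>
  The finite variation part \<open>X t - \<sigma> * B t\<close> has negative variation at most \<open>c\<close> on \<open>{0..1}\<close>, so its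
  total variation is at most its increment plus \<open>2 * c\<close>. This increment is integrable because
  \<open>X 0\<close> and \<open>X 1\<close> have the same law; it dominates the sums in the hypothesis \<open>lim\<close>.
\<close>

lemma (in brownian_motion) stationary_generator:
  fixes X :: "real \<Rightarrow> 'w \<Rightarrow> real" and \<sigma> c :: real and f f' f'' f''' g :: "real \<Rightarrow> real"
  assumes X: "\<And>t. 0 \<le> t \<Longrightarrow> X t \<in> borel_measurable (F t)"
    and stat: "stationary_law M X \<pi>"
    and c: "0 \<le> c"
    and lower: "AE \<omega> in M. \<forall>s t. 0 \<le> s \<longrightarrow> s \<le> t \<longrightarrow> t \<le> 1 \<longrightarrow>
      - c * (t - s) \<le> X t \<omega> - X s \<omega> - \<sigma> * (B t \<omega> - B s \<omega>)"
    and f': "\<And>x. (f has_real_derivative f' x) (at x)"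
    and f'': "\<And>x. (f' has_real_derivative f'' x) (at x)"
    and f''': "\<And>x. (f'' has_real_derivative f''' x) (at x)"
    and bounds: "\<And>x. \<bar>f x\<bar> \<le> C0" "\<And>x. \<bar>f' x\<bar> \<le> C1" "\<And>x. \<bar>f'' x\<bar> \<le> C2" "\<And>x. \<bar>f''' x\<bar> \<le> C3"
    and gm [measurable]: "g \<in> borel_measurable borel" and gb: "\<And>x. \<bar>g x\<bar> \<le> G"
    and lim: "AE \<omega> in M. (\<lambda>n. \<Sum>i<n. f (X (real (Suc i) / real n) \<omega>)
      - f (X (real i / real n) \<omega> + \<sigma> * (B (real (Suc i) / real n) \<omega> - B (real i / real n) \<omega>))
      - (real (Suc i) / real n - real i / real n) * g (X (real i / real n) \<omega>)) \<longlonglongrightarrow> 0"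
  shows "(\<integral>x. g x \<partial>\<pi>) + \<sigma>\<^sup>2 / 2 * (\<integral>x. f'' x \<partial>\<pi>) = 0"
proof -
  have XM [measurable]: "X t \<in> borel_measurable M" if "0 \<le> t" for t using F_measurable_imp X that by blast
  note BM [measurable] = B_measurable
  have fm [measurable]: "f \<in> borel_measurable borel" "f'' \<in> borel_measurable borel"
    using DERIV_isCont[OF f'] DERIV_isCont[OF f''']
    by (auto intro!: borel_measurable_continuous_onI continuous_at_imp_continuous_on)
  have law: "distr M borel (X t) = \<pi>" if "0 \<le> t" for t using stat that by (simp add: stationary_law_def)
  have ev: "expectation (\<lambda>\<omega>. \<phi> (X t \<omega>)) = (\<integral>x. \<phi> x \<partial>\<pi>)"
    if "0 \<le> t" "\<phi> \<in> borel_measurable borel" for t and \<phi> :: "real \<Rightarrow> real"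
    using that XM[of t] by (simp add: law[symmetric] integral_distr)
  define A where "A \<omega> = X 1 \<omega> - X 0 \<omega> - \<sigma> * (B 1 \<omega> - B 0 \<omega>)" for \<omega>
  have iB: "integrable M (\<lambda>\<omega>. \<sigma> * (B 1 \<omega> - B 0 \<omega>))"
    using increment_moments(2)[of 0 1 1] by (intro integrable_mult_right) (simp only: power_one_right zero_less_one order_refl)
  have "integrable M (\<lambda>\<omega>. X 1 \<omega> - X 0 \<omega>)"
  proof (rule integrable_diff_equal_law[where Y = "\<lambda>\<omega>. \<sigma> * (B 1 \<omega> - B 0 \<omega>) - c"])
    show "AE \<omega> in M. \<sigma> * (B 1 \<omega> - B 0 \<omega>) - c \<le> X 1 \<omega> - X 0 \<omega>"
      using lower
    proof eventually_elim
      case (elim \<omega>)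
      from elim[rule_format, of 0 1] show ?case by simp
    qed
  qed (use XM law iB in auto)
  then have iA: "integrable M A" unfolding A_def using iB by (rule Bochner_Integration.integrable_diff)
  define q where "q n i \<omega> = f (X (real (Suc i) / real n) \<omega>)
      - f (X (real i / real n) \<omega> + \<sigma> * (B (real (Suc i) / real n) \<omega> - B (real i / real n) \<omega>))" for n i \<omega>
  define R where "R n \<omega> = (\<Sum>i<n. q n i \<omega>
      - (real (Suc i) / real n - real i / real n) * g (X (real i / real n) \<omega>))" for n \<omega>
  have C: "0 \<le> C1" "0 \<le> C3" "0 \<le> G" using bounds(2)[of 0] bounds(4)[of 0] gb[of 0] by linarith+
  have qm [measurable]: "q n i \<in> borel_measurable M" for n i
    unfolding q_def by measurable
  have Rm [measurable]: "R n \<in> borel_measurable M" for n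
    unfolding R_def by measurable
  have step: "real (Suc i) / real n - real i / real n = 1 / real n" for i n
    by (simp add: diff_divide_distrib[symmetric])
  have dom: "AE \<omega> in M. \<bar>R n \<omega>\<bar> \<le> C1 * (\<bar>A \<omega>\<bar> + 2 * c) + G" for n
    using lower
  proof eventually_elim
    case (elim \<omega>)
    define a where "a t = X t \<omega> - \<sigma> * B t \<omega>" for t
    show ?case
    proof (cases "n = 0")
      case True
      then show ?thesis using C c by (simp add: R_def)
    next
      case False
      then have n: "0 < real n" by simp
      have "\<bar>R n \<omega>\<bar> \<le> (\<Sum>i<n. \<bar>q n i \<omega> - (real (Suc i) / real n - real i / real n) * g (X (real i / real n) \<omega>)\<bar>)"
        unfolding R_def by (rule sum_abs)
      also have "\<dots> \<le> (\<Sum>i<n. C1 * (a (real (Suc i) / real n) - a (real i / real n)) + (C1 * (2 * c) + G) * (1 / real n))"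
      proof (rule sum_mono)
        fix i assume "i \<in> {..<n}"
        then have i: "real (Suc i) / real n \<le> 1" using n by simp
        have i': "real i / real n \<le> real (Suc i) / real n" using n by (intro divide_right_mono) auto
        define da where "da = a (real (Suc i) / real n) - a (real i / real n)"
        have "- c * (real (Suc i) / real n - real i / real n) \<le> da"
          using elim[rule_format, of "real i / real n" "real (Suc i) / real n"] i i' n
          by (simp add: da_def a_def algebra_simps)
        then have "- (c * (1 / real n)) \<le> da" unfolding step by simp
        moreover have "0 \<le> c * (1 / real n)" using c by simp
        \<comment> \<open>A negative \<open>da\<close> has size at most \<open>c / n\<close>, so
          twice this amount turns it into a bound for the absolute value. What remains telescopes to
          \<open>A\<close>, uniformly in \<open>n\<close>.\<close>
        ultimately have da: "\<bar>da\<bar> \<le> da + 2 * c * (1 / real n)" by linarith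
        have "\<bar>q n i \<omega>\<bar> \<le> C1 * \<bar>da\<bar>"
          using deriv_bound_lipschitz[OF f' bounds(2), of "X (real (Suc i) / real n) \<omega>"
            "X (real i / real n) \<omega> + \<sigma> * (B (real (Suc i) / real n) \<omega> - B (real i / real n) \<omega>)"]
          by (simp add: q_def da_def a_def algebra_simps)
        also have "\<dots> \<le> C1 * (da + 2 * c * (1 / real n))" using da C by (intro mult_left_mono)
        finally have "\<bar>q n i \<omega>\<bar> \<le> C1 * (da + 2 * c * (1 / real n))" .
        moreover have "\<bar>1 / real n * g (X (real i / real n) \<omega>)\<bar> \<le> 1 / real n * G"
          unfolding abs_mult using gb n by (intro mult_mono) auto
        ultimately show "\<bar>q n i \<omega> - (real (Suc i) / real n - real i / real n) * g (X (real i / real n) \<omega>)\<bar>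
            \<le> C1 * (a (real (Suc i) / real n) - a (real i / real n)) + (C1 * (2 * c) + G) * (1 / real n)"
          unfolding step da_def[symmetric] distrib_left distrib_right by (simp only: ac_simps)
      qed
      also have "\<dots> = C1 * (a 1 - a 0) + (C1 * (2 * c) + G)"
        unfolding sum.distrib sum_distrib_left[symmetric] sum_lessThan_telescope[of "\<lambda>i. a (real i / real n)"]
        using n by simp
      also have "\<dots> = C1 * (A \<omega> + 2 * c) + G" by (simp add: a_def A_def algebra_simps)
      also have "\<dots> \<le> C1 * (\<bar>A \<omega>\<bar> + 2 * c) + G" using C by (simp add: mult_left_mono)
      finally show ?thesis .
    qed
  qed
  have "(\<lambda>n. expectation (R n)) \<longlonglongrightarrow> expectation (\<lambda>\<omega>. 0)"
  proof (rule integral_dominated_convergence[where w = "\<lambda>\<omega>. C1 * (\<bar>A \<omega>\<bar> + 2 * c) + G"])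
    show "integrable M (\<lambda>\<omega>. C1 * (\<bar>A \<omega>\<bar> + 2 * c) + G)" using iA by simp
    show "AE \<omega> in M. (\<lambda>n. R n \<omega>) \<longlonglongrightarrow> 0" using lim by (simp add: R_def q_def)
    show "AE \<omega> in M. norm (R n \<omega>) \<le> C1 * (\<bar>A \<omega>\<bar> + 2 * c) + G" for n using dom by simp
  qed auto
  then have R0: "(\<lambda>n. expectation (R n)) \<longlonglongrightarrow> 0" by simp
  define Q where "Q = (\<integral>x. g x \<partial>\<pi>) + \<sigma>\<^sup>2 / 2 * (\<integral>x. f'' x \<partial>\<pi>)"
  \<comment> \<open>Stationarity enters here: \<open>f (X t)\<close> and \<open>f (X s)\<close> have
    equal means, so the mean of \<open>q n i\<close> is minus that of the Gaussian bracket. Each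
    summand of \<open>R n\<close> then has mean \<open>- Q / n\<close> up to order n^(-3/2), and
    since the means of \<open>R n\<close> tend to 0, the constant \<open>Q\<close> must be
    0.\<close>
  have err: "\<bar>expectation (R n) + Q\<bar> \<le> 2 * C3 * \<bar>\<sigma>\<bar> ^ 3 * (1 / sqrt (real n))" if "0 < n" for n
  proof -
    have n: "0 < real n" using that by simp
    define J where "J i = expectation (\<lambda>\<omega>. q n i \<omega>
      - (real (Suc i) / real n - real i / real n) * g (X (real i / real n) \<omega>))" for i
    have if1: "integrable M (\<lambda>\<omega>. f (X t \<omega>))" if "0 \<le> t" for t
      by (rule integrable_const_bound[of _ C0]; use bounds XM that in simp)
    have ig: "integrable M (\<lambda>\<omega>. g (X t \<omega>))" if "0 \<le> t" for t
      by (rule integrable_const_bound[of _ G]; use gb XM that in simp)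
    have if2: "integrable M (\<lambda>\<omega>. f (X s \<omega> + \<sigma> * (B t \<omega> - B s \<omega>)))" if "0 \<le> t" "0 \<le> s" for s t
      by (rule integrable_const_bound[of _ C0]; use bounds XM BM that in simp)
    have iq: "integrable M (q n i)" for i unfolding q_def by (intro Bochner_Integration.integrable_diff if1 if2) auto
    have eR: "expectation (R n) = (\<Sum>i<n. J i)"
      unfolding R_def J_def by (intro Bochner_Integration.integral_sum Bochner_Integration.integrable_diff
          integrable_mult_right iq ig) simp
    have J: "\<bar>J i + Q / real n\<bar> \<le> C3 * (2 * (\<bar>\<sigma>\<bar> * sqrt (1 / real n)) ^ 3)" for i
    proof -
      define s t where "s = real i / real n" and "t = real (Suc i) / real n"
      have st: "0 \<le> s" "s < t" "0 \<le> t" "t - s = 1 / real n"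
        using n step[of i n] by (auto simp: s_def t_def divide_strict_right_mono)
      have Qn: "Q / real n = 1 / real n * (\<integral>x. g x \<partial>\<pi>) + \<sigma>\<^sup>2 / 2 * (1 / real n) * (\<integral>x. f'' x \<partial>\<pi>)"
        by (simp add: Q_def add_divide_distrib)
      have "J i = expectation (q n i) - (t - s) * expectation (\<lambda>\<omega>. g (X s \<omega>))"
        unfolding J_def s_def[symmetric] t_def[symmetric]
        by (subst Bochner_Integration.integral_diff) (use iq ig st in auto)
      also have "expectation (q n i) = expectation (\<lambda>\<omega>. f (X s \<omega>))
          - expectation (\<lambda>\<omega>. f (X s \<omega> + \<sigma> * (B t \<omega> - B s \<omega>)))"
        unfolding q_def s_def[symmetric] t_def[symmetric]
        by (subst Bochner_Integration.integral_diff) (use if1 if2 st ev fm in auto)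
      also have "\<dots> = - expectation (\<lambda>\<omega>. f (X s \<omega> + \<sigma> * (B t \<omega> - B s \<omega>)) - f (X s \<omega>))"
        by (subst Bochner_Integration.integral_diff) (use if1 if2 st in auto)
      finally have "J i + Q / real n = - (expectation (\<lambda>\<omega>. f (X s \<omega> + \<sigma> * (B t \<omega> - B s \<omega>)) - f (X s \<omega>))
          - \<sigma>\<^sup>2 / 2 * (t - s) * expectation (\<lambda>\<omega>. f'' (X s \<omega>)))"
        unfolding st(4) ev[OF st(1) gm] ev[OF st(1) fm(2)] Qn by linarith
      then show ?thesis
        using gaussian_step[OF st(1,2) X f' f'' f''' bounds, of \<sigma>] st by simp
    qed
    have "expectation (R n) + Q = (\<Sum>i<n. J i + Q / real n)"
      using n by (simp add: eR sum.distrib)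
    also have "\<bar>\<dots>\<bar> \<le> (\<Sum>i<n. C3 * (2 * (\<bar>\<sigma>\<bar> * sqrt (1 / real n)) ^ 3))"
      using sum_abs[of "\<lambda>i. J i + Q / real n" "{..<n}"] sum_mono[of "{..<n}", OF J] by (rule order_trans)
    also have "\<dots> = 2 * C3 * \<bar>\<sigma>\<bar> ^ 3 * (1 / sqrt (real n))"
      using n by (simp add: power_mult_distrib real_sqrt_divide power3_eq_cube divide_simps)
    finally show ?thesis .
  qed
  have "(\<lambda>n. 2 * C3 * \<bar>\<sigma>\<bar> ^ 3 * (1 / sqrt (real n))) \<longlonglongrightarrow> 2 * C3 * \<bar>\<sigma>\<bar> ^ 3 * 0"
    by (intro tendsto_intros tendsto_divide_0[OF tendsto_const] filterlim_compose[OF filterlim_at_top_imp_at_infinity]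
        filterlim_compose[OF sqrt_at_top] filterlim_real_sequentially filterlim_ident)
      (rule filterlim_ident | rule filterlim_compose[OF sqrt_at_top filterlim_real_sequentially])+
  then have "(\<lambda>n. expectation (R n) + Q) \<longlonglongrightarrow> 0"
    using err by (intro Lim_null_comparison[of "\<lambda>n. expectation (R n) + Q"])
      (auto intro!: eventually_sequentiallyI[of 1])
  moreover have "(\<lambda>n. expectation (R n) + Q) \<longlonglongrightarrow> 0 + Q" using R0 by (intro tendsto_intros)
  ultimately have "Q = 0" using LIMSEQ_unique by fastforce
  then show ?thesis by (simp add: Q_def)
qed

section \<open>The two diffusions\<close>

text \<open>A single term of the exponential series dominates the even power \<open>2 * k\<close>;
  the power \<open>k\<close> itself follows from
  \<open>\<bar>y ^ k\<bar> \<le> 1 + y ^ (2 * k)\<close>, which avoids a case split on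
  parity.\<close>

lemma power_times_gaussian_bounded:
  fixes \<theta> :: real
  assumes "0 < \<theta>"
  shows "\<exists>C. \<forall>y. \<bar>y ^ k * exp (- \<theta> * y\<^sup>2)\<bar> \<le> C"
proof (intro exI allI)
  fix y :: real
  have pos: "0 \<le> \<theta> * y\<^sup>2" using assms by simp
  have le: "(\<theta> * y\<^sup>2) ^ k / fact k \<le> exp (\<theta> * y\<^sup>2)"
  proof -
    have "(\<theta> * y\<^sup>2) ^ k / fact k \<le> (\<Sum>i\<in>{k}. inverse (fact i) *\<^sub>R (\<theta> * y\<^sup>2) ^ i)"
      by (simp add: divide_inverse mult.commute)
    also have "\<dots> \<le> (\<Sum>i. inverse (fact i) *\<^sub>R (\<theta> * y\<^sup>2) ^ i)"
      using pos summable_exp_generic[of "\<theta> * y\<^sup>2"] by (intro sum_le_suminf) auto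
    also have "\<dots> = exp (\<theta> * y\<^sup>2)" by (simp add: exp_def)
    finally show ?thesis .
  qed
  have "y ^ (2 * k) = (\<theta> * y\<^sup>2) ^ k / fact k * (fact k / \<theta> ^ k)"
    using assms by (simp add: power_mult_distrib power_mult)
  also have "\<dots> \<le> exp (\<theta> * y\<^sup>2) * (fact k / \<theta> ^ k)"
    using assms by (intro mult_right_mono le) simp
  finally have even: "y ^ (2 * k) * exp (- \<theta> * y\<^sup>2) \<le> fact k / \<theta> ^ k"
    by (simp add: exp_minus field_simps)
  have "\<bar>y ^ k\<bar> \<le> 1 + y ^ (2 * k)"
    using sum_squares_bound[of "\<bar>y ^ k\<bar>" 1] by (simp add: power_mult[symmetric] mult.commute)
  then have "\<bar>y ^ k * exp (- \<theta> * y\<^sup>2)\<bar> \<le> (1 + y ^ (2 * k)) * exp (- \<theta> * y\<^sup>2)"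
    unfolding abs_mult by (simp add: mult_right_mono)
  also have "\<dots> = exp (- \<theta> * y\<^sup>2) + y ^ (2 * k) * exp (- \<theta> * y\<^sup>2)" by (simp add: algebra_simps)
  also have "\<dots> \<le> 1 + fact k / \<theta> ^ k" using pos by (intro add_mono even) simp
  finally show "\<bar>y ^ k * exp (- \<theta> * y\<^sup>2)\<bar> \<le> 1 + fact k / \<theta> ^ k" .
qed

text \<open>The centre 1 is the left end of both state spaces. Differentiation and, for positive
  order, division by \<open>x - 1\<close> lead to linear combinations of the same family, so both
  generators can be expressed in it.\<close>

definition gauss_moment :: "real \<Rightarrow> nat \<Rightarrow> real \<Rightarrow> real" where
  "gauss_moment \<theta> k x = (x - 1) ^ k * exp (- \<theta> * (x - 1)\<^sup>2)"

lemma gauss_moment_measurable [measurable]: "gauss_moment \<theta> k \<in> borel_measurable borel"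
  unfolding gauss_moment_def by measurable

lemma gauss_moment_bounded: "0 < \<theta> \<Longrightarrow> \<exists>C. \<forall>x. \<bar>gauss_moment \<theta> k x\<bar> \<le> C"
  unfolding gauss_moment_def using power_times_gaussian_bounded[of \<theta> k] by blast

text \<open>Two terms are enough for the antiderivative of order 1, its higher derivatives and both
  drift functions \<open>g\<close>, with a zero coefficient where only one term occurs.\<close>

lemma gauss_moment_lincomb_bounded:
  assumes "0 < \<theta>"
  shows "\<exists>C. \<forall>x. \<bar>a * gauss_moment \<theta> j x + b * gauss_moment \<theta> k x\<bar> \<le> C"
proof -
  obtain C D where C: "\<And>x. \<bar>gauss_moment \<theta> j x\<bar> \<le> C" and D: "\<And>x. \<bar>gauss_moment \<theta> k x\<bar> \<le> D"
    using gauss_moment_bounded[OF assms] by metis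
  have "\<bar>a * gauss_moment \<theta> j x + b * gauss_moment \<theta> k x\<bar> \<le> \<bar>a\<bar> * C + \<bar>b\<bar> * D" for x
    using abs_triangle_ineq[of "a * gauss_moment \<theta> j x" "b * gauss_moment \<theta> k x"]
      mult_left_mono[OF C[of x], of "\<bar>a\<bar>"] mult_left_mono[OF D[of x], of "\<bar>b\<bar>"]
    by (simp add: abs_mult)
  then show ?thesis by blast
qed

lemma gauss_moment_deriv_0:
  "(gauss_moment \<theta> 0 has_real_derivative - 2 * \<theta> * gauss_moment \<theta> 1 x) (at x)"
  unfolding gauss_moment_def by (auto intro!: derivative_eq_intros)

lemma gauss_moment_deriv_Suc:
  "(gauss_moment \<theta> (Suc k) has_real_derivative
    real (Suc k) * gauss_moment \<theta> k x - 2 * \<theta> * gauss_moment \<theta> (Suc (Suc k)) x) (at x)"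
  unfolding gauss_moment_def
  by (rule derivative_eq_intros refl | simp add: algebra_simps)+

text \<open>Fixes the test function once for both diffusions. The path lemmas use only the
  derivative of \<open>f\<close>, so the hypothesis \<open>lim\<close> is asked for every
  antiderivative of \<open>gauss_moment \<theta> 1\<close>, and the bounded one is chosen inside the
  proof.\<close>

lemma (in brownian_motion) stationary_gaussian_generator:
  fixes X :: "real \<Rightarrow> 'w \<Rightarrow> real" and \<sigma> c \<theta> :: real and g :: "real \<Rightarrow> real"
  assumes \<theta>: "0 < \<theta>"
    and X: "\<And>t. 0 \<le> t \<Longrightarrow> X t \<in> borel_measurable (F t)"
    and stat: "stationary_law M X \<pi>"
    and c: "0 \<le> c"
    and lower: "AE \<omega> in M. \<forall>s t. 0 \<le> s \<longrightarrow> s \<le> t \<longrightarrow> t \<le> 1 \<longrightarrow>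
      - c * (t - s) \<le> X t \<omega> - X s \<omega> - \<sigma> * (B t \<omega> - B s \<omega>)"
    and gm: "g \<in> borel_measurable borel" and gb: "\<And>x. \<bar>g x\<bar> \<le> G"
    and lim: "\<And>f :: real \<Rightarrow> real. (\<And>x. (f has_real_derivative gauss_moment \<theta> 1 x) (at x)) \<Longrightarrow>
      AE \<omega> in M. (\<lambda>n. \<Sum>i<n. f (X (real (Suc i) / real n) \<omega>)
        - f (X (real i / real n) \<omega> + \<sigma> * (B (real (Suc i) / real n) \<omega> - B (real i / real n) \<omega>))
        - (real (Suc i) / real n - real i / real n) * g (X (real i / real n) \<omega>)) \<longlonglongrightarrow> 0"
  shows "(\<integral>x. g x \<partial>\<pi>) + \<sigma>\<^sup>2 / 2 * (\<integral>x. gauss_moment \<theta> 0 x - 2 * \<theta> * gauss_moment \<theta> 2 x \<partial>\<pi>) = 0"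
proof -
  define f where "f x = - 1 / (2 * \<theta>) * gauss_moment \<theta> 0 x" for x
  define f'' where "f'' x = gauss_moment \<theta> 0 x - 2 * \<theta> * gauss_moment \<theta> 2 x" for x
  define f''' where "f''' x = - 6 * \<theta> * gauss_moment \<theta> 1 x + 4 * \<theta>\<^sup>2 * gauss_moment \<theta> 3 x" for x
  have d1: "(f has_real_derivative gauss_moment \<theta> 1 x) (at x)" for x
    using DERIV_cmult[OF gauss_moment_deriv_0[of \<theta> x], of "- 1 / (2 * \<theta>)"] \<theta> by (simp add: f_def[abs_def])
  have d2: "(gauss_moment \<theta> 1 has_real_derivative f'' x) (at x)" for x
    using gauss_moment_deriv_Suc[of \<theta> 0 x] by (simp add: f''_def eval_nat_numeral)
  have d3: "(f'' has_real_derivative f''' x) (at x)" for x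
  proof -
    have "(f'' has_real_derivative - 2 * \<theta> * gauss_moment \<theta> 1 x
        - 2 * \<theta> * (2 * gauss_moment \<theta> 1 x - 2 * \<theta> * gauss_moment \<theta> 3 x)) (at x)"
      unfolding f''_def[abs_def]
      using gauss_moment_deriv_Suc[of \<theta> 1 x]
      by (intro DERIV_diff DERIV_cmult gauss_moment_deriv_0) (simp add: eval_nat_numeral)
    then show ?thesis by (simp add: f'''_def algebra_simps power2_eq_square)
  qed
  obtain C0 where C0: "\<And>x. \<bar>f x\<bar> \<le> C0"
    using gauss_moment_lincomb_bounded[OF \<theta>, of "- 1 / (2 * \<theta>)" 0 0 0] by (auto simp: f_def)
  obtain C1 where C1: "\<And>x. \<bar>gauss_moment \<theta> 1 x\<bar> \<le> C1" using gauss_moment_bounded[OF \<theta>] by blast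
  obtain C2 where C2: "\<And>x. \<bar>f'' x\<bar> \<le> C2"
    using gauss_moment_lincomb_bounded[OF \<theta>, of 1 0 "- 2 * \<theta>" 2] by (auto simp: f''_def)
  obtain C3 where C3: "\<And>x. \<bar>f''' x\<bar> \<le> C3"
    using gauss_moment_lincomb_bounded[OF \<theta>, of "- 6 * \<theta>" 1 "4 * \<theta>\<^sup>2" 3] by (auto simp: f'''_def)
  show ?thesis
    using stationary_generator[OF X stat c lower d1 d2 d3 C0 C1 C2 C3 gm gb lim[OF d1]]
    unfolding f''_def .
qed

lemma gauss_moment_integrable:
  assumes "prob_space \<pi>" "sets \<pi> = sets borel" "0 < \<theta>"
  shows "integrable \<pi> (gauss_moment \<theta> k)"
proof -
  interpret prob_space \<pi> by fact
  obtain C where "\<And>x. \<bar>gauss_moment \<theta> k x\<bar> \<le> C" using gauss_moment_bounded[OF assms(3)] by blast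
  then show ?thesis
    by (intro integrable_const_bound[of _ C]) (auto simp: measurable_cong_sets[OF assms(2) refl])
qed

lemma stationary_law_prob:
  assumes "prob_space M" "stationary_law M X \<pi>" "X 0 \<in> borel_measurable M"
  shows "prob_space \<pi>" "sets \<pi> = sets borel"
  using assms prob_space.prob_space_distr[OF assms(1,3)] by (auto simp: stationary_law_def)

section \<open>Stationarity identities for the two diffusions\<close>

text \<open>\<open>gauss_moment \<theta> 0\<close> arises twice with the same weight: once from the
  singular drift times \<open>f'\<close>, once from \<open>f''\<close>. With
  \<open>\<sigma> = sqrt (2 * \<mu>)\<close> the coefficient of \<open>f''\<close> is
  \<open>\<mu>\<close>, so \<open>\<mu>\<close> factors out of the whole relation.\<close>

lemma (in IQF_diffusion) stationary_identity:
  assumes \<mu>: "0 < \<mu>" and \<alpha>: "0 < \<alpha>" and \<theta>: "0 < \<theta>" and stat: "stationary_law M N \<pi>"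
  shows "(\<integral>x. \<alpha> * gauss_moment \<theta> 1 x + 2 * \<theta> * gauss_moment \<theta> 2 x \<partial>\<pi>) =
    2 * (\<integral>x. gauss_moment \<theta> 0 x \<partial>\<pi>)"
proof -
  \<comment> \<open>This is \<open>f'\<close> times the drift with the factor \<open>x - 1\<close>
    already cancelled. It is bounded on the whole line and agrees with the product wherever
    \<open>1 < x\<close>, which is where the path lives.\<close>
  define g where "g x = \<mu> * (gauss_moment \<theta> 0 x - \<alpha> * gauss_moment \<theta> 1 x)" for x
  define h where "h \<omega> t = \<mu> * (1 / (N t \<omega> - 1) - \<alpha>)" for \<omega> t
  have path: "AE \<omega> in M. continuous_on {0..1} (\<lambda>t. N t \<omega>) \<and> continuous_on {0..1} (\<lambda>t. B t \<omega>) \<and>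
      continuous_on {0..1} (h \<omega>) \<and> (\<forall>t\<ge>0. 1 < N t \<omega>) \<and>
      (\<forall>s t. 0 \<le> s \<longrightarrow> s \<le> t \<longrightarrow> t \<le> 1 \<longrightarrow>
        N t \<omega> - N s \<omega> - sqrt (2 * \<mu>) * (B t \<omega> - B s \<omega>) = integral {s..t} (h \<omega>))"
    using N_continuous continuous_paths N_range sde
  proof eventually_elim
    case (elim \<omega>)
    have Nc: "continuous_on {0..1} (\<lambda>t. N t \<omega>)" by (rule continuous_on_subset[OF elim(1)]) auto
    have hc: "continuous_on {0..1} (h \<omega>)"
      unfolding h_def[abs_def] using elim(3) by (intro continuous_intros Nc) force
    have "N t \<omega> - N s \<omega> - sqrt (2 * \<mu>) * (B t \<omega> - B s \<omega>) = integral {s..t} (h \<omega>)"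
      if "0 \<le> s" "s \<le> t" "t \<le> 1" for s t
    proof -
      have "h \<omega> integrable_on {0..t}"
        using that by (intro integrable_continuous_real continuous_on_subset[OF hc]) auto
      from Henstock_Kurzweil_Integration.integral_combine[OF that(1,2) this]
      have "integral {0..t} (h \<omega>) - integral {0..s} (h \<omega>) = integral {s..t} (h \<omega>)" by simp
      moreover have "N u \<omega> = N 0 \<omega> + integral {0..u} (h \<omega>) + sqrt (2 * \<mu>) * B u \<omega>" if "0 \<le> u" for u
        using elim(4)[folded h_def, rule_format, OF that] .
      note this[of s] this[of t]
      ultimately show ?thesis using that by (simp add: algebra_simps)
    qed
    then show ?case using Nc hc elim(3) continuous_on_subset[OF elim(2), of "{0..1}"] by auto
  qed
  obtain G where "\<And>x. \<bar>(\<mu>) * gauss_moment \<theta> 0 x + (- \<mu> * \<alpha>) * gauss_moment \<theta> 1 x\<bar> \<le> G"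
    using gauss_moment_lincomb_bounded[OF \<theta>] by metis
  then have gb: "\<bar>g x\<bar> \<le> G" for x by (simp add: g_def algebra_simps)
  have gm: "g \<in> borel_measurable borel" unfolding g_def by measurable
  \<comment> \<open>The repulsion \<open>1 / (N - 1)\<close> is positive, so only the constant drift
    can lower the finite variation part; this gives the rate
    \<open>\<alpha> * \<mu>\<close>.\<close>
  have lower: "AE \<omega> in M. \<forall>s t. 0 \<le> s \<longrightarrow> s \<le> t \<longrightarrow> t \<le> 1 \<longrightarrow>
      - (\<alpha> * \<mu>) * (t - s) \<le> N t \<omega> - N s \<omega> - sqrt (2 * \<mu>) * (B t \<omega> - B s \<omega>)"
    using path
  proof (eventually_elim, intro allI impI)
    fix \<omega> and s t :: real
    assume p: "continuous_on {0..1} (\<lambda>t. N t \<omega>) \<and> continuous_on {0..1} (\<lambda>t. B t \<omega>) \<and>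
      continuous_on {0..1} (h \<omega>) \<and> (\<forall>t\<ge>0. 1 < N t \<omega>) \<and>
      (\<forall>s t. 0 \<le> s \<longrightarrow> s \<le> t \<longrightarrow> t \<le> 1 \<longrightarrow>
        N t \<omega> - N s \<omega> - sqrt (2 * \<mu>) * (B t \<omega> - B s \<omega>) = integral {s..t} (h \<omega>))"
      and st: "0 \<le> s" "s \<le> t" "t \<le> 1"
    have hc: "continuous_on {s..t} (h \<omega>)"
      using p continuous_on_subset[of "{0..1}" "h \<omega>" "{s..t}"] st by auto
    have "integral {s..t} (\<lambda>_. - (\<alpha> * \<mu>)) \<le> integral {s..t} (h \<omega>)"
    proof (rule integral_le)
      fix u assume "u \<in> {s..t}"
      then have "1 < N u \<omega>" using p st by auto
      then have "0 \<le> \<mu> * (1 / (N u \<omega> - 1))" using \<mu> by simp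
      then show "- (\<alpha> * \<mu>) \<le> h \<omega> u" by (simp add: h_def algebra_simps)
    qed (use hc in \<open>auto intro: integrable_continuous_real\<close>)
    then show "- (\<alpha> * \<mu>) * (t - s) \<le> N t \<omega> - N s \<omega> - sqrt (2 * \<mu>) * (B t \<omega> - B s \<omega>)"
      using p st by (simp add: ac_simps)
  qed
  have "(\<integral>x. g x \<partial>\<pi>) + (sqrt (2 * \<mu>))\<^sup>2 / 2 * (\<integral>x. gauss_moment \<theta> 0 x - 2 * \<theta> * gauss_moment \<theta> 2 x \<partial>\<pi>) = 0"
  proof (rule stationary_gaussian_generator[OF \<theta> N_adapted stat _ lower gm gb])
    show "0 \<le> \<alpha> * \<mu>" using \<alpha> \<mu> by simp
    fix f :: "real \<Rightarrow> real" assume f': "\<And>x. (f has_real_derivative gauss_moment \<theta> 1 x) (at x)"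
    obtain C1 where b1: "\<And>x. \<bar>gauss_moment \<theta> 1 x\<bar> \<le> C1" using gauss_moment_bounded[OF \<theta>] by blast
    have f'': "(gauss_moment \<theta> 1 has_real_derivative 1 * gauss_moment \<theta> 0 x + (- 2 * \<theta>) * gauss_moment \<theta> 2 x) (at x)" for x
      using gauss_moment_deriv_Suc[of \<theta> 0 x] by (simp add: eval_nat_numeral)
    obtain C2 where b2: "\<And>x. \<bar>1 * gauss_moment \<theta> 0 x + (- 2 * \<theta>) * gauss_moment \<theta> 2 x\<bar> \<le> C2"
      using gauss_moment_lincomb_bounded[OF \<theta>] by metis
    show "AE \<omega> in M. (\<lambda>n. \<Sum>i<n. f (N (real (Suc i) / real n) \<omega>)
        - f (N (real i / real n) \<omega> + sqrt (2 * \<mu>) * (B (real (Suc i) / real n) \<omega> - B (real i / real n) \<omega>))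
        - (real (Suc i) / real n - real i / real n) * g (N (real i / real n) \<omega>)) \<longlonglongrightarrow> 0"
      using path
    proof eventually_elim
      case (elim \<omega>)
      show ?case
      proof (rule drift_sum_tendsto_zero[where h = "h \<omega>", OF _ _ _ _ f' f'' b1 b2])
        fix t :: real assume "0 \<le> t"
        then have "1 < N t \<omega>" using elim by blast
        then show "g (N t \<omega>) = gauss_moment \<theta> 1 (N t \<omega>) * h \<omega> t"
          by (simp add: g_def h_def gauss_moment_def field_simps)
      qed (use elim in auto)
    qed
  qed
  moreover note stationary_law_prob[OF prob_space_axioms stat F_measurable_imp[OF _ N_adapted], simplified]
  note i = gauss_moment_integrable[OF this \<theta>]
  ultimately have "\<mu> * (2 * (\<integral>x. gauss_moment \<theta> 0 x \<partial>\<pi>) -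
      (\<integral>x. \<alpha> * gauss_moment \<theta> 1 x + 2 * \<theta> * gauss_moment \<theta> 2 x \<partial>\<pi>)) = 0"
    using \<mu> by (simp add: g_def i algebra_simps)
  then show ?thesis using \<mu> by simp
qed

text \<open>The reflection term only pushes upwards, so the downward rate is again
  \<open>\<alpha> * \<mu>\<close>, and it leaves no trace in \<open>g\<close> because
  \<open>gauss_moment \<theta> 1\<close> vanishes at 1. Here \<open>gauss_moment \<theta> 0\<close>
  comes from \<open>f''\<close> alone.\<close>

lemma (in CQ_diffusion) stationary_identity:
  assumes \<mu>: "0 < \<mu>" and \<alpha>: "0 < \<alpha>" and \<theta>: "0 < \<theta>" and stat: "stationary_law M N \<pi>"
  shows "(\<integral>x. \<alpha> * gauss_moment \<theta> 1 x + 2 * \<theta> * gauss_moment \<theta> 2 x \<partial>\<pi>) =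
    (\<integral>x. gauss_moment \<theta> 0 x \<partial>\<pi>)"
proof -
  define g where "g x = - (\<alpha> * \<mu>) * gauss_moment \<theta> 1 x" for x
  have path: "AE \<omega> in M. continuous_on {0..1} (\<lambda>t. N t \<omega>) \<and> continuous_on {0..1} (\<lambda>t. B t \<omega>) \<and>
      (\<forall>t\<ge>0. 1 \<le> N t \<omega>) \<and> (\<forall>s t. 0 \<le> s \<longrightarrow> s \<le> t \<longrightarrow> L s \<omega> \<le> L t \<omega>) \<and>
      (\<forall>s t. 0 \<le> s \<longrightarrow> s \<le> t \<longrightarrow> (\<forall>u\<in>{s..t}. 1 < N u \<omega>) \<longrightarrow> L s \<omega> = L t \<omega>) \<and>
      (\<forall>s t. 0 \<le> s \<longrightarrow> s \<le> t \<longrightarrow>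
        N t \<omega> - N s \<omega> - sqrt (2 * \<mu>) * (B t \<omega> - B s \<omega>) = (L t \<omega> - L s \<omega>) - (\<alpha> * \<mu>) * (t - s))"
    using N_continuous continuous_paths N_range sde L_mono L_reflection
  proof eventually_elim
    case (elim \<omega>)
    have "N t \<omega> - N s \<omega> - sqrt (2 * \<mu>) * (B t \<omega> - B s \<omega>) = (L t \<omega> - L s \<omega>) - (\<alpha> * \<mu>) * (t - s)"
      if "0 \<le> s" "s \<le> t" for s t
      using elim(4)[rule_format, of t] elim(4)[rule_format, of s] that by (simp add: algebra_simps)
    moreover have "L s \<omega> \<le> L t \<omega>" if "0 \<le> s" "s \<le> t" for s t
      using that by (intro mono_onD[OF elim(5)]) auto
    ultimately show ?case
      using continuous_on_subset[OF elim(1), of "{0..1}"] continuous_on_subset[OF elim(2), of "{0..1}"]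
        elim(3,6) by auto
  qed
  obtain G where "\<And>x. \<bar>(- (\<alpha> * \<mu>)) * gauss_moment \<theta> 1 x + 0 * gauss_moment \<theta> 0 x\<bar> \<le> G"
    using gauss_moment_lincomb_bounded[OF \<theta>] by metis
  then have gb: "\<bar>g x\<bar> \<le> G" for x by (simp add: g_def)
  have gm: "g \<in> borel_measurable borel" unfolding g_def by measurable
  have lower: "AE \<omega> in M. \<forall>s t. 0 \<le> s \<longrightarrow> s \<le> t \<longrightarrow> t \<le> 1 \<longrightarrow>
      - (\<alpha> * \<mu>) * (t - s) \<le> N t \<omega> - N s \<omega> - sqrt (2 * \<mu>) * (B t \<omega> - B s \<omega>)"
    using path by eventually_elim simp
  have "(\<integral>x. g x \<partial>\<pi>) + (sqrt (2 * \<mu>))\<^sup>2 / 2 * (\<integral>x. gauss_moment \<theta> 0 x - 2 * \<theta> * gauss_moment \<theta> 2 x \<partial>\<pi>) = 0"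
  proof (rule stationary_gaussian_generator[OF \<theta> N_adapted stat _ lower gm gb])
    show "0 \<le> \<alpha> * \<mu>" using \<alpha> \<mu> by simp
    fix f :: "real \<Rightarrow> real" assume f': "\<And>x. (f has_real_derivative gauss_moment \<theta> 1 x) (at x)"
    have f'': "(gauss_moment \<theta> 1 has_real_derivative 1 * gauss_moment \<theta> 0 x + (- 2 * \<theta>) * gauss_moment \<theta> 2 x) (at x)" for x
      using gauss_moment_deriv_Suc[of \<theta> 0 x] by (simp add: eval_nat_numeral)
    obtain C2 where b2: "\<And>x. \<bar>1 * gauss_moment \<theta> 0 x + (- 2 * \<theta>) * gauss_moment \<theta> 2 x\<bar> \<le> C2"
      using gauss_moment_lincomb_bounded[OF \<theta>] by metis
    show "AE \<omega> in M. (\<lambda>n. \<Sum>i<n. f (N (real (Suc i) / real n) \<omega>)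
        - f (N (real i / real n) \<omega> + sqrt (2 * \<mu>) * (B (real (Suc i) / real n) \<omega> - B (real i / real n) \<omega>))
        - (real (Suc i) / real n - real i / real n) * g (N (real i / real n) \<omega>)) \<longlonglongrightarrow> 0"
      using path
    proof eventually_elim
      case (elim \<omega>)
      show ?case unfolding g_def
      proof (rule reflection_sum_tendsto_zero[where l = "\<lambda>t. L t \<omega>" and r = 1, OF _ _ _ _ _ _ _ f' f'' b2])
        show "gauss_moment \<theta> 1 1 = 0" by (simp add: gauss_moment_def)
        show "0 \<le> \<alpha> * \<mu>" using \<alpha> \<mu> by simp
      qed (use elim in auto)
    qed
  qed
  moreover note stationary_law_prob[OF prob_space_axioms stat F_measurable_imp[OF _ N_adapted], simplified]
  note i = gauss_moment_integrable[OF this \<theta>]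
  ultimately have "\<mu> * ((\<integral>x. gauss_moment \<theta> 0 x \<partial>\<pi>) -
      (\<integral>x. \<alpha> * gauss_moment \<theta> 1 x + 2 * \<theta> * gauss_moment \<theta> 2 x \<partial>\<pi>)) = 0"
    using \<mu> by (simp add: g_def i algebra_simps)
  then show ?thesis using \<mu> by simp
qed

section \<open>Means of the stationary laws\<close>

text \<open>The limit is taken twice: Fatou first yields integrability of \<open>x - 1\<close>, and
  only then can a multiple of \<open>x - 1\<close> dominate and give the value. The term of order
  two tends to 0 pointwise and stays below \<open>2 * (x - 1)\<close>, so it disappears, while the
  right-hand side tends to \<open>c\<close>.\<close>

lemma mean_of_gaussian_identity:
  fixes \<pi> :: "real measure"
  assumes "prob_space \<pi>" and sets: "sets \<pi> = sets borel"
    and ge: "AE x in \<pi>. 1 \<le> x" and \<alpha>: "0 < \<alpha>"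
    and id: "\<And>\<theta>. 0 < \<theta> \<Longrightarrow> (\<integral>x. \<alpha> * gauss_moment \<theta> 1 x + 2 * \<theta> * gauss_moment \<theta> 2 x \<partial>\<pi>) =
      c * (\<integral>x. gauss_moment \<theta> 0 x \<partial>\<pi>)"
  shows "integrable \<pi> (\<lambda>x. x)" "(\<integral>x. x \<partial>\<pi>) = 1 + c / \<alpha>"
proof -
  interpret prob_space \<pi> by fact
  note [measurable_cong] = sets
  define \<theta> :: "nat \<Rightarrow> real" where "\<theta> n = inverse (real (Suc n))" for n
  have \<theta>: "0 < \<theta> n" "\<theta> n \<le> 1" for n by (auto simp: \<theta>_def field_simps)
  have \<theta>0: "\<theta> \<longlonglongrightarrow> 0" unfolding \<theta>_def[abs_def] by (rule LIMSEQ_inverse_real_of_nat)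
  define H where "H n x = \<alpha> * gauss_moment (\<theta> n) 1 x + 2 * \<theta> n * gauss_moment (\<theta> n) 2 x" for n x
  have gi: "integrable \<pi> (gauss_moment (\<theta> n) k)" for n k
    using gauss_moment_integrable assms \<theta> by blast
  have Hi: "integrable \<pi> (H n)" for n unfolding H_def using gi by simp
  have [measurable]: "H n \<in> borel_measurable borel" for n unfolding H_def by measurable
  have g01: "0 \<le> gauss_moment (\<theta> n) 0 x" "gauss_moment (\<theta> n) 0 x \<le> 1" for n x
    using \<theta>[of n] by (auto simp: gauss_moment_def)
  have g_lim: "(\<lambda>n. gauss_moment (\<theta> n) k x) \<longlonglongrightarrow> (x - 1) ^ k" for k x
  proof -
    have "(\<lambda>n. (x - 1) ^ k * exp (- \<theta> n * (x - 1)\<^sup>2)) \<longlonglongrightarrow> (x - 1) ^ k * exp (- 0 * (x - 1)\<^sup>2)"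
      by (intro tendsto_intros \<theta>0)
    then show ?thesis by (simp add: gauss_moment_def)
  qed
  have H_lim: "(\<lambda>n. H n x) \<longlonglongrightarrow> \<alpha> * (x - 1)" for x
  proof -
    have "(\<lambda>n. H n x) \<longlonglongrightarrow> \<alpha> * (x - 1) ^ 1 + 2 * 0 * (x - 1) ^ 2"
      unfolding H_def by (intro tendsto_intros g_lim \<theta>0)
    then show ?thesis by simp
  qed
  have H_nonneg: "0 \<le> H n x" if "1 \<le> x" for n x
    using that \<alpha> \<theta>[of n] by (simp add: H_def gauss_moment_def)
  have eH: "expectation (H n) = c * expectation (gauss_moment (\<theta> n) 0)" for n
    using id[OF \<theta>(1)] by (simp add: H_def[abs_def])
  have "expectation (gauss_moment (\<theta> n) 0) \<le> 1" for n
    using integral_mono[OF gi[of n 0], of "\<lambda>_. 1"] g01 by (simp add: prob_space)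
  moreover have "0 \<le> expectation (gauss_moment (\<theta> n) 0)" for n by (rule Bochner_Integration.integral_nonneg) (use g01 in auto)
  ultimately have eH_le: "expectation (H n) \<le> \<bar>c\<bar>" for n
    unfolding eH by (smt (verit, best) mult_left_le mult_right_mono mult_minus_left mult_nonneg_nonneg)
  \<comment> \<open>Fatou asks only for a uniform bound on the means of \<open>H n\<close>; almost
    sure nonnegativity lets the identity supply it.\<close>
  have "(\<integral>\<^sup>+x. ennreal (\<alpha> * (x - 1)) \<partial>\<pi>) = (\<integral>\<^sup>+x. liminf (\<lambda>n. ennreal (H n x)) \<partial>\<pi>)"
    by (intro nn_integral_cong lim_imp_Liminf[symmetric] tendsto_ennrealI H_lim) auto
  also have "\<dots> \<le> liminf (\<lambda>n. \<integral>\<^sup>+x. ennreal (H n x) \<partial>\<pi>)" by (rule nn_integral_liminf) simp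
  also have "\<dots> \<le> limsup (\<lambda>n. \<integral>\<^sup>+x. ennreal (H n x) \<partial>\<pi>)" by (rule Liminf_le_Limsup) simp
  also have "\<dots> \<le> ennreal \<bar>c\<bar>"
  proof (rule Limsup_bounded, rule always_eventually, rule allI)
    fix n
    have "(\<integral>\<^sup>+x. ennreal (H n x) \<partial>\<pi>) = ennreal (expectation (H n))"
      using ge H_nonneg by (intro nn_integral_eq_integral Hi) auto
    then show "(\<integral>\<^sup>+x. ennreal (H n x) \<partial>\<pi>) \<le> ennreal \<bar>c\<bar>" using eH_le by (simp add: ennreal_leI)
  qed
  also have "\<dots> < \<infinity>" by simp
  finally have "integrable \<pi> (\<lambda>x. \<alpha> * (x - 1))"
    using ge \<alpha> by (intro integrableI_nonneg) auto
  from integrable_mult_right[OF this, of "1 / \<alpha>"]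
  have i1: "integrable \<pi> (\<lambda>x. x - 1)" using \<alpha> by simp
  from Bochner_Integration.integrable_add[OF this integrable_const[of 1]]
  show ix: "integrable \<pi> (\<lambda>x. x)" by simp
  have "(\<lambda>n. expectation (H n)) \<longlonglongrightarrow> expectation (\<lambda>x. \<alpha> * (x - 1))"
  proof (rule integral_dominated_convergence[where w = "\<lambda>x. (\<alpha> + 2) * (x - 1)"])
    show "AE x in \<pi>. (\<lambda>n. H n x) \<longlonglongrightarrow> \<alpha> * (x - 1)" using H_lim by simp
    show "AE x in \<pi>. norm (H n x) \<le> (\<alpha> + 2) * (x - 1)" for n
      using ge
    proof eventually_elim
      case (elim x)
      define y where "y = x - 1"
      have y: "0 \<le> y" using elim by (simp add: y_def)
      have E: "exp (- \<theta> n * y\<^sup>2) \<le> 1" using \<theta>[of n] by simp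
      \<comment> \<open>For \<open>y \<le> 1\<close> the bounds \<open>\<theta> n \<le> 1\<close>
        and \<open>y * y \<le> y\<close> suffice; for larger \<open>y\<close> the inequality z *
        exp(-z) <= 1 does. The result is linear in \<open>y\<close> and independent of
        \<open>n\<close>.\<close>
      have "\<theta> n * y\<^sup>2 * exp (- \<theta> n * y\<^sup>2) \<le> y"
      proof (cases "y \<le> 1")
        case True
        have "\<theta> n * y\<^sup>2 \<le> y" unfolding power2_eq_square
          using \<theta>[of n] True y mult_mono[of "\<theta> n" 1 "y * y" y] mult_left_le[of y y] by simp
        from mult_mono[OF this E] have "\<theta> n * y\<^sup>2 * exp (- \<theta> n * y\<^sup>2) \<le> y * 1" using y by simp
        then show ?thesis by simp
      next
        case False
        have "\<theta> n * y\<^sup>2 \<le> exp (\<theta> n * y\<^sup>2)" using exp_ge_add_one_self[of "\<theta> n * y\<^sup>2"] by linarith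
        then have "\<theta> n * y\<^sup>2 * exp (- \<theta> n * y\<^sup>2) \<le> 1" by (simp add: exp_minus field_simps)
        then show ?thesis using False by simp
      qed
      moreover have "\<alpha> * (y * exp (- \<theta> n * y\<^sup>2)) \<le> \<alpha> * (y * 1)"
        using E y \<alpha> by (intro mult_left_mono) auto
      ultimately have "H n x \<le> (\<alpha> + 2) * y"
        unfolding H_def gauss_moment_def y_def[symmetric] by (simp add: algebra_simps)
      then show ?case using H_nonneg[OF elim] by (simp add: y_def)
    qed
  qed (use i1 in auto)
  moreover have "(\<lambda>n. expectation (H n)) \<longlonglongrightarrow> c * 1"
  proof -
    have "(\<lambda>n. expectation (gauss_moment (\<theta> n) 0)) \<longlonglongrightarrow> expectation (\<lambda>x. 1)"
      by (rule integral_dominated_convergence[where w = "\<lambda>x. 1"]) (use g01 g_lim[of 0] in auto)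
    then show ?thesis unfolding eH by (intro tendsto_intros) (simp add: prob_space)
  qed
  ultimately have "expectation (\<lambda>x. \<alpha> * (x - 1)) = c" using LIMSEQ_unique by fastforce
  then show "(\<integral>x. x \<partial>\<pi>) = 1 + c / \<alpha>" using \<alpha> ix by (simp add: prob_space field_simps)
qed

lemma IQF_stationary_mean:
  assumes "IQF_stationary_distribution TYPE('v) \<mu> \<alpha> \<pi>" "0 < \<mu>" "0 < \<alpha>"
  shows "integrable \<pi> (\<lambda>x. x)" "(\<integral>x. x \<partial>\<pi>) = 1 + 2 / \<alpha>"
proof -
  obtain M :: "'v measure" and F B N where "IQF_diffusion M F B N \<mu> \<alpha>" and stat: "stationary_law M N \<pi>"
    using assms(1) unfolding IQF_stationary_distribution_def by blast
  then interpret IQF_diffusion M F B N \<mu> \<alpha> by simp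
  have m: "N 0 \<in> borel_measurable M" using F_measurable_imp N_adapted by blast
  have "distr M borel (N 0) = \<pi>" using stat by (simp add: stationary_law_def)
  moreover have "AE \<omega> in M. 1 \<le> N 0 \<omega>" using N_range by eventually_elim (simp add: less_imp_le)
  ultimately have "AE x in \<pi>. 1 \<le> x" using m by (auto simp: AE_distr_iff)
  note * = mean_of_gaussian_identity[OF stationary_law_prob[OF prob_space_axioms stat m] this assms(3)
    stationary_identity[OF assms(2,3) _ stat]]
  show "integrable \<pi> (\<lambda>x. x)" "(\<integral>x. x \<partial>\<pi>) = 1 + 2 / \<alpha>" using * by blast+
qed

lemma CQ_stationary_mean:
  assumes "CQ_stationary_distribution TYPE('v) \<mu> \<alpha> \<pi>" "0 < \<mu>" "0 < \<alpha>"
  shows "integrable \<pi> (\<lambda>x. x)" "(\<integral>x. x \<partial>\<pi>) = 1 + 1 / \<alpha>"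
proof -
  obtain M :: "'v measure" and F B N L where "CQ_diffusion M F B N L \<mu> \<alpha>" and stat: "stationary_law M N \<pi>"
    using assms(1) unfolding CQ_stationary_distribution_def by blast
  then interpret CQ_diffusion M F B N L \<mu> \<alpha> by simp
  have m: "N 0 \<in> borel_measurable M" using F_measurable_imp N_adapted by blast
  have "distr M borel (N 0) = \<pi>" using stat by (simp add: stationary_law_def)
  moreover have "AE \<omega> in M. 1 \<le> N 0 \<omega>" using N_range by eventually_elim simp
  ultimately have "AE x in \<pi>. 1 \<le> x" using m by (auto simp: AE_distr_iff)
  note * = mean_of_gaussian_identity[where c = 1, unfolded mult_1, OF
    stationary_law_prob[OF prob_space_axioms stat m] this assms(3) stationary_identity[OF assms(2,3) _ stat]]
  show "integrable \<pi> (\<lambda>x. x)" "(\<integral>x. x \<partial>\<pi>) = 1 + 1 / \<alpha>" using * by blast+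
qed

section \<open>The supremum of the ratio\<close>

theorem mainTheorem3:
  fixes \<mu> :: real and \<pi>_IQF \<pi>_CQ :: "real \<Rightarrow> real measure"
  assumes "\<mu> > 0"
    and "\<And>\<alpha>. \<alpha> > 0 \<Longrightarrow> IQF_stationary_distribution TYPE('v) \<mu> \<alpha> (\<pi>_IQF \<alpha>)"
    and "\<And>\<alpha>. \<alpha> > 0 \<Longrightarrow> CQ_stationary_distribution TYPE('w) \<mu> \<alpha> (\<pi>_CQ \<alpha>)"
  shows "(\<forall>\<alpha>>0. integrable (\<pi>_IQF \<alpha>) (\<lambda>x. x) \<and> integrable (\<pi>_CQ \<alpha>) (\<lambda>x. x)) \<and>
    (SUP \<alpha>\<in>{0<..}. ereal ((\<integral>x. x \<partial>\<pi>_IQF \<alpha>) / (\<integral>x. x \<partial>\<pi>_CQ \<alpha>))) = 2"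
proof
  note IQF = IQF_stationary_mean[OF assms(2) assms(1)] and CQ = CQ_stationary_mean[OF assms(3) assms(1)]
  show "\<forall>\<alpha>>0. integrable (\<pi>_IQF \<alpha>) (\<lambda>x. x) \<and> integrable (\<pi>_CQ \<alpha>) (\<lambda>x. x)"
    using IQF(1) CQ(1) by blast
  have ratio: "(\<integral>x. x \<partial>\<pi>_IQF \<alpha>) / (\<integral>x. x \<partial>\<pi>_CQ \<alpha>) = (\<alpha> + 2) / (\<alpha> + 1)" if "0 < \<alpha>" for \<alpha>
  proof -
    have "1 + 2 / \<alpha> = (\<alpha> + 2) / \<alpha>" "1 + 1 / \<alpha> = (\<alpha> + 1) / \<alpha>" using that by (simp_all add: field_simps)
    then show ?thesis using IQF(2)[OF that that] CQ(2)[OF that that] that by simp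
  qed
  show "(SUP \<alpha>\<in>{0<..}. ereal ((\<integral>x. x \<partial>\<pi>_IQF \<alpha>) / (\<integral>x. x \<partial>\<pi>_CQ \<alpha>))) = 2"
  proof (rule SUP_eqI)
    fix \<alpha> :: real assume "\<alpha> \<in> {0<..}"
    then have "0 < \<alpha>" by simp
    then have "(\<alpha> + 2) / (\<alpha> + 1) \<le> 2" by (simp add: field_simps)
    then show "ereal ((\<integral>x. x \<partial>\<pi>_IQF \<alpha>) / (\<integral>x. x \<partial>\<pi>_CQ \<alpha>)) \<le> 2"
      using ratio[OF \<open>0 < \<alpha>\<close>] by (simp add: numeral_eq_ereal)
  next
    fix y :: ereal
    assume y: "\<And>\<alpha>. \<alpha> \<in> {0<..} \<Longrightarrow> ereal ((\<integral>x. x \<partial>\<pi>_IQF \<alpha>) / (\<integral>x. x \<partial>\<pi>_CQ \<alpha>)) \<le> y"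
    \<comment> \<open>The ratio stays strictly below 2 and approaches it only as
      \<open>\<alpha>\<close> tends to 0, so the least upper bound is tested along a sequence of
      parameters decreasing to 0.\<close>
    define a where "a n = inverse (real (Suc n))" for n
    have "(\<lambda>n. (a n + 2) / (a n + 1)) \<longlonglongrightarrow> (0 + 2) / (0 + 1)"
      unfolding a_def by (intro tendsto_intros LIMSEQ_inverse_real_of_nat) simp
    then have "(\<lambda>n. ereal ((a n + 2) / (a n + 1))) \<longlonglongrightarrow> ereal 2" by simp
    moreover have "ereal ((a n + 2) / (a n + 1)) \<le> y" for n
      using y[of "a n"] ratio[of "a n"] by (simp add: a_def)
    ultimately show "2 \<le> y" unfolding numeral_eq_ereal using LIMSEQ_le_const2 by blast
  qed
qed

end
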